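(* Assume that $\mathbf{Z}^{(n)}_1,\ldots,\mathbf{Z}^{(n)}_n$ are i.i.d. on $\mathcal{S}^{d-1}$ with common distribution in $\mathfrak{P}_d$ and common optimal transport map (directional distribution function) $\mathbf{F}$. Let $\mathbf{F}_0$ be the directional distribution function of a specified distribution $\mathrm{P}_0\in\mathfrak{P}_d$, let $\mathbf{F}^{(n)}$ be the empirical directional distribution function based on an $n$-point grid $\mathfrak{G}^{(n)}\subset\mathcal{S}^{d-1}$, and let $$T_n=n^{-1}\sum_{i=1}^n\big\|\mathbf{F}^{(n)}(\mathbf{Z}^{(n)}_i)-\mathbf{F}_0(\mathbf{Z}^{(n)}_i)\big\|^2.$$ Then, provided that the uniform discrete distribution over the $n$-point grid $\mathfrak{G}^{(n)}$ converges weakly, as $n\to\infty$, to the uniform distribution $\mathrm{P}^{\mathbf{U}}$ over $\mathcal{S}^{d-1}$: (i) $T_n=o_{\mathrm{P}}(1)$ as $n\to\infty$ under the null hypothesis $\mathcal{H}_0:\mathbf{F}=\mathbf{F}_0$; (ii) $T_n$ converges in probability to a strictly positive constant as $n\to\infty$ if $\mathbf{F}\neq\mathbf{F}_0$.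
   Context: Let $d\ge 2$ and $\mathcal{S}^{d-1}=\{\mathbf{x}\in\mathbb{R}^d:\|\mathbf{x}\|=1\}$, with surface area measure $\lambda^{d-1}$. Let $c(\mathbf{y},\mathbf{z})=\tfrac12 d(\mathbf{y},\mathbf{z})^2$ with $d(\mathbf{y},\mathbf{z})=\arccos(\mathbf{y}^\top\mathbf{z})$. $\mathfrak{P}_d$ is the family of probability measures on $\mathcal{S}^{d-1}$ that are absolutely continuous with respect to $\lambda^{d-1}$ with densities bounded away from zero and infinity. For $\mathrm{P}\in\mathfrak{P}_d$, the directional distribution function of $\mathrm{P}$ is the $\mathrm{P}$-a.s. unique minimizer of $\int c(\mathbf{z},\mathbf{S}(\mathbf{z}))\,\mathrm{d}\mathrm{P}(\mathbf{z})$ among measurable $\mathbf{S}:\mathcal{S}^{d-1}\to\mathcal{S}^{d-1}$ pushing $\mathrm{P}$ forward to $\mathrm{P}^{\mathbf{U}}$ (taken in its continuous version, which is a homeomorphism). Given a grid $\mathfrak{G}^{(n)}=\{\mathfrak{g}^{(n)}_1,\ldots,\mathfrak{g}^{(n)}_n\}$, the empirical directional distribution function $\mathbf{F}^{(n)}$ is a bijection from $\{\mathbf{Z}^{(n)}_1,\ldots,\mathbf{Z}^{(n)}_n\}$ to $\mathfrak{G}^{(n)}$ satisfying $$\sum_{i=1}^n c\big(\mathbf{Z}^{(n)}_i,\mathbf{F}^{(n)}(\mathbf{Z}^{(n)}_i)\big)=\min_{T}\sum_{i=1}^n c\big(\mathbf{Z}^{(n)}_i,\mathfrak{g}^{(n)}_{T(i)}\big),$$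 the minimum being over all permutations $T$ of $\{1,\ldots,n\}$. *)

theory Defs
  imports "HOL-Probability.Probability"
begin

abbreviation usphere :: "'a::euclidean_space set" where
  "usphere \<equiv> sphere 0 1"

abbreviation sphere_borel :: "'a::euclidean_space measure" where
  "sphere_borel \<equiv> restrict_space borel usphere"

text \<open>
  Surface area measure on the unit sphere of a \<open>d\<close>-dimensional Euclidean space, as in the
  formula for integration in polar coordinates: the area of \<open>A\<close> is \<open>d\<close> times the Lebesgue
  measure of the cone \<open>{t x | 0 < t \<le> 1, x \<in> A}\<close> (see \<open>emeasure_surface_measure\<close> below).
  The map \<^const>\<open>sgn\<close> is the radial projection \<open>x / norm x\<close>.
\<close>

definition surface_measure :: "'a::euclidean_space measure" where
  "surface_measure =
     scale_measure (ennreal (real DIM('a)))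
       (distr (restrict_space lborel (cball 0 1 - {0})) sphere_borel sgn)"

definition uniform_sphere :: "'a::euclidean_space measure" where
  "uniform_sphere = uniform_measure surface_measure usphere"

definition geodesic_dist :: "'a::euclidean_space \<Rightarrow> 'a \<Rightarrow> real" where
  "geodesic_dist y z = arccos (y \<bullet> z)"

definition cost :: "'a::euclidean_space \<Rightarrow> 'a \<Rightarrow> real" where
  "cost y z = (geodesic_dist y z)\<^sup>2 / 2"

definition directional_family :: "'a::euclidean_space measure set" where
  "directional_family =
     {P. prob_space P \<and>
         (\<exists>f a b. f \<in> borel_measurable surface_measure \<and>
                  P = density surface_measure (\<lambda>x. ennreal (f x)) \<and>
                  0 < a \<and> (\<forall>x\<in>usphere. a \<le> f x \<and> f x \<le> b))}"

definition transports :: "'a::euclidean_space measure \<Rightarrow> ('a \<Rightarrow> 'a) \<Rightarrow> bool" where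
  "transports P S \<longleftrightarrow>
     S \<in> sphere_borel \<rightarrow>\<^sub>M sphere_borel \<and> distr P sphere_borel S = uniform_sphere"

definition transport_cost :: "'a::euclidean_space measure \<Rightarrow> ('a \<Rightarrow> 'a) \<Rightarrow> real" where
  "transport_cost P S = (\<integral>z. cost z (S z) \<partial>P)"

text \<open>
  A directional distribution function of \<open>P\<close> is a continuous version of the optimal transport
  map from \<open>P\<close> to the uniform distribution. For \<open>P\<close> in \<^const>\<open>directional_family\<close> the minimizer
  is unique up to \<open>P\<close>-null sets and its continuous version is a homeomorphism of the sphere;
  these are theorems and therefore not part of the definition. Only the values on the sphere
  are meaningful.
\<close>

definition directional_df :: "'a::euclidean_space measure \<Rightarrow> ('a \<Rightarrow> 'a) \<Rightarrow> bool" where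
  "directional_df P F \<longleftrightarrow>
     transports P F \<and> continuous_on usphere F \<and>
     (\<forall>S. transports P S \<longrightarrow> transport_cost P F \<le> transport_cost P S)"

text \<open>
  Here \<open>z 1, \<dots>, z n\<close> is a (realized) sample and \<open>g 1, \<dots>, g n\<close> are the grid points. For distinct
  grid points the bijection can only exist if the sample points are distinct too.
\<close>

definition empirical_df ::
    "nat \<Rightarrow> (nat \<Rightarrow> 'a::euclidean_space) \<Rightarrow> (nat \<Rightarrow> 'a) \<Rightarrow> ('a \<Rightarrow> 'a) \<Rightarrow> bool" where
  "empirical_df n z g F \<longleftrightarrow>
     bij_betw F (z ` {1..n}) (g ` {1..n}) \<and>
     (\<Sum>i=1..n. cost (z i) (F (z i))) =
       Min ((\<lambda>T. \<Sum>i=1..n. cost (z i) (g (T i))) ` {T. T permutes {1..n}})"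

definition uniform_grid :: "nat \<Rightarrow> (nat \<Rightarrow> 'a::euclidean_space) \<Rightarrow> 'a measure" where
  "uniform_grid n g = distr (uniform_count_measure (g ` {1..n})) sphere_borel (\<lambda>x. x)"

definition weak_conv_sphere ::
    "(nat \<Rightarrow> 'a::euclidean_space measure) \<Rightarrow> 'a measure \<Rightarrow> bool" where
  "weak_conv_sphere \<mu> \<nu> \<longleftrightarrow>
     (\<forall>f :: 'a \<Rightarrow> real. continuous_on usphere f \<and> bounded (f ` usphere) \<longrightarrow>
        (\<lambda>n. \<integral>x. f x \<partial>\<mu> n) \<longlonglongrightarrow> (\<integral>x. f x \<partial>\<nu>))"

text \<open>
  Convergence in probability to a constant. An optimal matching need not be unique, so an
  arbitrary choice of it (and any statistic computed from it) need not depend measurably on the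
  sample. The outer measure covers that case; for measurable \<open>X n\<close> it makes no difference
  (see \<open>conv_in_prob_measurable\<close> below).
\<close>

definition conv_in_prob :: "'w measure \<Rightarrow> (nat \<Rightarrow> 'w \<Rightarrow> real) \<Rightarrow> real \<Rightarrow> bool" where
  "conv_in_prob M X c \<longleftrightarrow>
     (\<forall>\<epsilon>>0. (\<lambda>n. outer_measure_of M {\<omega> \<in> space M. \<bar>X n \<omega> - c\<bar> > \<epsilon>}) \<longlonglongrightarrow> 0)"

definition T_stat ::
    "(nat \<Rightarrow> nat \<Rightarrow> 'w \<Rightarrow> 'a::euclidean_space) \<Rightarrow> (nat \<Rightarrow> 'w \<Rightarrow> 'a \<Rightarrow> 'a) \<Rightarrow> ('a \<Rightarrow> 'a)
       \<Rightarrow> nat \<Rightarrow> 'w \<Rightarrow> real" where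
  "T_stat Z Fn F0 n \<omega> =
     (\<Sum>i=1..n. (norm (Fn n \<omega> (Z n i \<omega>) - F0 (Z n i \<omega>)))\<^sup>2) / real n"


lemma sgn_measurable_sphere:
  "sgn \<in> restrict_space lborel (cball (0::'a::euclidean_space) 1 - {0}) \<rightarrow>\<^sub>M sphere_borel"
proof (rule measurable_restrict_space2)
  show "sgn \<in> space (restrict_space lborel (cball (0::'a) 1 - {0})) \<rightarrow> usphere"
    by (auto simp: space_restrict_space norm_sgn)
  show "sgn \<in> restrict_space lborel (cball (0::'a) 1 - {0}) \<rightarrow>\<^sub>M borel"
    by (intro measurable_restrict_space1) simp
qed

lemma sets_surface_measure [simp, measurable_cong]:
  "sets surface_measure = sets (sphere_borel :: 'a::euclidean_space measure)"
  by (simp add: surface_measure_def)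

lemma space_surface_measure [simp]: "space (surface_measure :: 'a::euclidean_space measure) = usphere"
  by (simp add: surface_measure_def space_scale_measure space_restrict_space)

lemma emeasure_surface_measure:
  fixes A :: "'a::euclidean_space set"
  assumes A: "A \<in> sets sphere_borel"
  shows "emeasure surface_measure A =
           ennreal (real DIM('a)) * emeasure lborel {t *\<^sub>R x | t x. 0 < t \<and> t \<le> 1 \<and> x \<in> A}"
proof -
  have sub: "A \<subseteq> usphere"
    using sets.sets_into_space[OF A] by (simp add: space_restrict_space)
  have eq: "sgn -` A \<inter> (cball 0 1 - {0}) = {t *\<^sub>R x | t x. 0 < t \<and> t \<le> 1 \<and> x \<in> A}"
    (is "?L = ?R")
  proof (intro set_eqI iffI)
    fix y assume y: "y \<in> ?L"
    have "y = norm y *\<^sub>R sgn y" using y by (auto simp: sgn_div_norm)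
    moreover have "0 < norm y" "norm y \<le> 1" "sgn y \<in> A" using y by auto
    ultimately show "y \<in> ?R" by blast
  next
    fix y assume "y \<in> ?R"
    then obtain t x where y: "y = t *\<^sub>R x" "0 < t" "t \<le> 1" "x \<in> A" by blast
    have n: "norm x = 1" using y sub by auto
    then have "sgn x = x" by (simp add: sgn_div_norm)
    then show "y \<in> ?L" using y n by (auto simp: sgn_scaleR)
  qed
  have "emeasure (distr (restrict_space lborel (cball 0 1 - {0})) sphere_borel sgn) A
      = emeasure (restrict_space lborel (cball 0 1 - {0})) (sgn -` A \<inter> (cball 0 1 - {0}))"
    by (subst emeasure_distr[OF sgn_measurable_sphere A]) (simp add: space_restrict_space)
  also have "\<dots> = emeasure lborel (sgn -` A \<inter> (cball 0 1 - {0}))"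
    by (rule emeasure_restrict_space) auto
  finally show ?thesis
    by (simp add: surface_measure_def eq)
qed

lemma conv_in_prob_measurable:
  assumes "prob_space M" and X: "\<And>n. X n \<in> borel_measurable M"
  shows "conv_in_prob M X c \<longleftrightarrow>
           (\<forall>\<epsilon>>0. (\<lambda>n. measure M {\<omega> \<in> space M. \<bar>X n \<omega> - c\<bar> > \<epsilon>}) \<longlonglongrightarrow> 0)"
proof -
  interpret prob_space M by fact
  have [measurable]: "X n \<in> borel_measurable M" for n by (rule X)
  have "{\<omega> \<in> space M. \<bar>X n \<omega> - c\<bar> > \<epsilon>} \<in> sets M" for n \<epsilon>
    by measurable
  then show ?thesis
    by (simp add: conv_in_prob_def emeasure_eq_measure tendsto_ennreal_iff[where x=0, simplified])
qed

end

theory Submission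
  imports Defs "HOL-Complex_Analysis.Great_Picard" "HOL-Combinatorics.Cycles"
begin

text \<open>
  The map \<open>F\<close> is characterised by a dual potential \<open>\<psi>\<close>. Among all continuous functions on the
  sphere, the dual value \<open>\<integral>\<psi> dU + \<integral>\<psi>\<^sup>c dP\<close> with \<open>\<psi>\<^sup>c x = min\<^sub>y (c(x, y) - \<psi> y)\<close> and \<open>U\<close> the uniform
  distribution has a maximiser (\<open>dual_maximiser\<close>, by Arzela--Ascoli). Its slack
  \<open>D(x, y) = c(x, y) - \<psi>\<^sup>c x - \<psi> y\<close> is nonnegative, and for almost every \<open>x\<close> it vanishes at a single
  \<open>y\<close> (\<open>ambiguous_points_null\<close>): two different partners \<open>y\<close> of the same \<open>x\<close> would make \<open>\<psi>\<^sup>c\<close> lie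
  below two touching functions with different gradients, hence give it a concave corner along some
  axis (an antipodal partner does so by itself), and corners along a common axis keep their distance from each other, so that they form a
  null set. The first-order condition for the maximiser says that the map sending \<open>x\<close> to its partner
  transports \<open>P\<close> to \<open>U\<close>; comparing costs, \<open>F\<close> must be that map (\<open>directional_df_potential\<close>).

  An optimal matching of finitely many points has dual potentials too (\<open>assignment_potentials\<close>,
  shortest-path distances in a graph without negative cycles). They extend to the sphere with the
  modulus of continuity of the cost and so belong, up to constants, to one compact family. Once the
  averages of a finite net of this family over the sample and the grid are close to their means, the
  average cost of the matching exceeds the dual value only slightly (\<open>optimal_matching_cost_le\<close>),
  which is the same as saying that the average of \<open>D(Z\<^sub>i, F\<^sub>n(Z\<^sub>i))\<close> is small.

  To pass from small slack to small distance, one uses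
  \<open>norm (y - F x) \<le> m\<^sub>k x + k D(x, y)\<close> with \<open>m\<^sub>k x = max\<^sub>y (norm (y - F x) - k D(x, y))\<close>. The functions
  \<open>m\<^sub>k\<close> are continuous and tend to \<open>0\<close> almost everywhere as \<open>k \<longlongrightarrow> \<infinity>\<close>, because \<open>F x\<close> is the only zero
  of \<open>D(x, _)\<close>. Hence the average distance between the matching and \<open>F\<close> tends to \<open>0\<close> in probability
  by the law of large numbers for finitely many continuous functions (\<open>optimal_matching_close\<close>,
  \<open>weak_law_continuous\<close>), and the statistic converges to \<open>\<integral>(norm (F x - F0 x))\<^sup>2 dP\<close>
  (\<open>T_stat_limit\<close>). This constant is \<open>0\<close> if the two maps agree, and it is positive otherwise since
  the maps are continuous and nonempty open sets have positive probability.
\<close>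

section \<open>Maxima of continuous functions over one variable on the sphere\<close>

definition fibre_max :: "('a::euclidean_space \<Rightarrow> 'a \<Rightarrow> real) \<Rightarrow> 'a \<Rightarrow> real" where
  "fibre_max f x = (SUP y\<in>usphere. f x y)"

abbreviation continuous2 :: "('a::euclidean_space \<Rightarrow> 'a \<Rightarrow> real) \<Rightarrow> bool" where
  "continuous2 f \<equiv> continuous_on (usphere \<times> usphere) (\<lambda>p. f (fst p) (snd p))"

lemma usphere_not_empty: "usphere \<noteq> ({} :: 'a::euclidean_space set)"
  by (simp add: sphere_eq_empty)

lemma continuous2_one_variable:
  "continuous_on usphere f \<Longrightarrow> continuous2 (\<lambda>x y. f x)"
  "continuous_on usphere f \<Longrightarrow> continuous2 (\<lambda>x y. f y)"
  by (rule continuous_on_compose2[of usphere f]; auto intro!: continuous_intros)+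

lemma continuous2_section:
  assumes "continuous2 f" "x \<in> usphere"
  shows "continuous_on usphere (f x)"
proof -
  have "continuous_on usphere ((\<lambda>p. f (fst p) (snd p)) \<circ> (\<lambda>y. (x, y)))"
    by (rule continuous_on_compose) (use assms in \<open>auto intro!: continuous_intros elim!: continuous_on_subset\<close>)
  then show ?thesis by (simp add: o_def)
qed

lemma continuous2_graph:
  assumes "continuous2 f" and S: "continuous_on usphere S" "S ` usphere \<subseteq> usphere"
  shows "continuous_on usphere (\<lambda>x. f x (S x))"
proof -
  have "continuous_on usphere ((\<lambda>p. f (fst p) (snd p)) \<circ> (\<lambda>x. (x, S x)))"
    by (rule continuous_on_compose) (use assms in \<open>auto intro!: continuous_intros elim!: continuous_on_subset\<close>)
  then show ?thesis by (simp add: o_def)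
qed

lemma continuous2_bounded:
  assumes "continuous2 f"
  obtains B where "0 < B" "\<And>x y. x \<in> usphere \<Longrightarrow> y \<in> usphere \<Longrightarrow> \<bar>f x y\<bar> \<le> B"
proof -
  have "compact ((\<lambda>p. f (fst p) (snd p)) ` (usphere \<times> usphere))"
    using assms by (intro compact_continuous_image compact_Times) auto
  then obtain B where "\<And>p. p \<in> usphere \<times> usphere \<Longrightarrow> \<bar>f (fst p) (snd p)\<bar> \<le> B"
    by (fastforce dest!: compact_imp_bounded simp: bounded_iff)
  then have "\<bar>f x y\<bar> \<le> max B 1" if "x \<in> usphere" "y \<in> usphere" for x y
    using that by (metis SigmaI fst_conv snd_conv max.coboundedI1)
  then show ?thesis using that[of "max B 1"] by simp
qed

lemma continuous2_uniform:
  assumes "continuous2 f" "0 < e"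
  obtains d where "0 < d"
    "\<And>x x' y. x \<in> usphere \<Longrightarrow> x' \<in> usphere \<Longrightarrow> y \<in> usphere \<Longrightarrow> norm (x - x') < d
      \<Longrightarrow> \<bar>f x y - f x' y\<bar> < e"
proof -
  have "uniformly_continuous_on (usphere \<times> usphere) (\<lambda>p. f (fst p) (snd p))"
    using assms by (intro compact_uniformly_continuous compact_Times) auto
  then obtain d where d: "0 < d" "\<And>p p'. p \<in> usphere \<times> usphere \<Longrightarrow> p' \<in> usphere \<times> usphere \<Longrightarrow>
      dist p' p < d \<Longrightarrow> dist (f (fst p') (snd p')) (f (fst p) (snd p)) < e"
    using \<open>0 < e\<close> unfolding uniformly_continuous_on_def by metis
  show ?thesis
  proof (rule that[OF d(1)])
    fix x x' y :: 'a assume "x \<in> usphere" "x' \<in> usphere" "y \<in> usphere" "norm (x - x') < d"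
    then show "\<bar>f x y - f x' y\<bar> < e"
      using d(2)[of "(x', y)" "(x, y)"] by (simp add: dist_Pair_Pair dist_norm)
  qed
qed

lemma fibre_max_attained:
  assumes "continuous2 f" "x \<in> usphere"
  obtains y where "y \<in> usphere" "fibre_max f x = f x y" "\<And>y'. y' \<in> usphere \<Longrightarrow> f x y' \<le> f x y"
proof -
  obtain y where y: "y \<in> usphere" "\<And>y'. y' \<in> usphere \<Longrightarrow> f x y' \<le> f x y"
    using continuous_attains_sup[OF compact_sphere usphere_not_empty continuous2_section[OF assms]]
    by blast
  have "fibre_max f x = f x y"
    unfolding fibre_max_def by (rule cSup_eq_maximum) (use y in auto)
  with y show ?thesis using that by blast
qed

lemma fibre_max_upper:
  assumes "continuous2 f" "x \<in> usphere" "y \<in> usphere"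
  shows "f x y \<le> fibre_max f x"
  using fibre_max_attained[OF assms(1,2)] assms(3) by force

lemma fibre_max_least:
  assumes "continuous2 f" "x \<in> usphere" "\<And>y. y \<in> usphere \<Longrightarrow> f x y \<le> b"
  shows "fibre_max f x \<le> b"
  using fibre_max_attained[OF assms(1,2)] assms(3) by force

lemma continuous_fibre_max:
  assumes f: "continuous2 f"
  shows "continuous_on usphere (fibre_max f)"
proof -
  have "\<exists>d>0. \<forall>x'\<in>usphere. dist x' x < d \<longrightarrow> dist (fibre_max f x') (fibre_max f x) < e"
    if "0 < e" "x \<in> usphere" for x e
  proof -
    obtain d where d: "0 < d" "\<And>x x' y. x \<in> usphere \<Longrightarrow> x' \<in> usphere \<Longrightarrow> y \<in> usphere
        \<Longrightarrow> norm (x - x') < d \<Longrightarrow> \<bar>f x y - f x' y\<bar> < e"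
      by (rule continuous2_uniform[OF f \<open>0 < e\<close>]) (rule that)
    have *: "fibre_max f a < fibre_max f b + e"
      if ab: "a \<in> usphere" "b \<in> usphere" "norm (a - b) < d" for a b
    proof -
      obtain y where y: "y \<in> usphere" "fibre_max f a = f a y"
        using fibre_max_attained[OF f ab(1)] by metis
      then show ?thesis
        using d(2)[OF ab(1,2) y(1) ab(3)] fibre_max_upper[OF f ab(2) y(1)] by linarith
    qed
    show ?thesis
    proof (intro exI[of _ d] conjI ballI impI)
      fix x' assume "x' \<in> usphere" "dist x' x < d"
      then show "dist (fibre_max f x') (fibre_max f x) < e"
        using *[of x x'] *[of x' x] \<open>x \<in> usphere\<close>
        by (simp add: dist_norm norm_minus_commute)
    qed (rule d(1))
  qed
  then show ?thesis by (auto simp: continuous_on_iff)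
qed

text \<open>
  Penalising by a large multiple of \<open>D\<close> forces the maximum onto the zero set of \<open>D\<close>. This
  replaces every appeal to weak convergence of couplings: a statement about the optimal
  matching of a point \<open>x\<close> is turned into one about a continuous function of \<open>x\<close> alone.
\<close>

lemma fibre_max_penalised_limit:
  assumes f: "continuous2 f" and D: "continuous2 D"
    and D0: "\<And>y. y \<in> usphere \<Longrightarrow> 0 \<le> D x y"
    and x: "x \<in> usphere" and y0: "y0 \<in> usphere" "D x y0 = 0"
    and unique: "\<And>y. y \<in> usphere \<Longrightarrow> D x y = 0 \<Longrightarrow> y = y0"
  shows "(\<lambda>k. fibre_max (\<lambda>x y. f x y - real k * D x y) x) \<longlonglongrightarrow> f x y0"
proof (rule LIMSEQ_I)
  fix e :: real assume "0 < e"
  have c: "continuous2 (\<lambda>x y. f x y - real k * D x y)" for k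
    by (intro continuous_intros f D)
  obtain B where B: "0 < B" "\<And>y. y \<in> usphere \<Longrightarrow> \<bar>f x y\<bar> \<le> B"
    using continuous2_bounded[OF f] x by metis
  define K where "K = {y \<in> usphere. f x y0 + e/2 \<le> f x y}"
  have cf: "continuous_on usphere (f x)" and cD: "continuous_on usphere (D x)"
    by (rule continuous2_section[OF f x], rule continuous2_section[OF D x])
  have "compact K"
    using compact_Int_closed[OF compact_sphere[of 0 1]
        continuous_on_closed_Collect_le[OF continuous_on_const cf closed_sphere, of "f x y0 + e/2"]]
    by (rule back_subst[of compact]) (auto simp: K_def)
  have "\<exists>\<delta>>0. \<forall>y\<in>K. \<delta> \<le> D x y"
  proof (cases "K = {}")
    case True then show ?thesis by (auto intro: exI[of _ 1])
  next
    case False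
    have "continuous_on K (D x)" by (rule continuous_on_subset[OF cD]) (auto simp: K_def)
    then obtain y1 where y1: "y1 \<in> K" "\<forall>y\<in>K. D x y1 \<le> D x y"
      using continuous_attains_inf[OF \<open>compact K\<close> False] by blast
    have "D x y1 \<noteq> 0" using y1(1) unique[of y1] \<open>0 < e\<close> by (auto simp: K_def)
    then have "0 < D x y1" using D0[of y1] y1(1) by (auto simp: K_def)
    with y1(2) show ?thesis by blast
  qed
  then obtain \<delta> where \<delta>: "0 < \<delta>" "\<And>y. y \<in> K \<Longrightarrow> \<delta> \<le> D x y" by blast
  obtain N :: nat where N: "2 * B / \<delta> < N" using reals_Archimedean2 by blast
  show "\<exists>N. \<forall>k\<ge>N. norm (fibre_max (\<lambda>x y. f x y - real k * D x y) x - f x y0) < e"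
  proof (intro exI allI impI)
    fix k assume "N \<le> k"
    have low: "f x y0 \<le> fibre_max (\<lambda>x y. f x y - real k * D x y) x"
      using fibre_max_upper[OF c[of k] x y0(1)] y0(2) by simp
    have "fibre_max (\<lambda>x y. f x y - real k * D x y) x \<le> f x y0 + e/2"
    proof (rule fibre_max_least[OF c x])
      fix y :: 'a assume y: "y \<in> usphere"
      show "f x y - real k * D x y \<le> f x y0 + e/2"
      proof (cases "y \<in> K")
        case True
        have "2 * B / \<delta> \<le> real k" using N \<open>N \<le> k\<close> by linarith
        then have "2 * B \<le> real k * \<delta>" using \<delta>(1) by (simp add: pos_divide_le_eq)
        also have "\<dots> \<le> real k * D x y" using \<delta>(2)[OF True] by (intro mult_left_mono) auto
        finally show ?thesis using B(2)[OF y] B(2)[OF y0(1)] \<open>0 < e\<close> by linarith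
      next
        case False
        then have "f x y < f x y0 + e/2" using y by (auto simp: K_def)
        moreover have "0 \<le> real k * D x y" using D0[OF y] by simp
        ultimately show ?thesis by linarith
      qed
    qed
    with low \<open>0 < e\<close> show "norm (fibre_max (\<lambda>x y. f x y - real k * D x y) x - f x y0) < e"
      by simp
  qed
qed

section \<open>The cost and its conjugates\<close>

lemma inner_usphere_abs_le: "x \<in> usphere \<Longrightarrow> y \<in> usphere \<Longrightarrow> \<bar>x \<bullet> y\<bar> \<le> (1::real)"
  using Cauchy_Schwarz_ineq2[of x y] by simp

lemma inner_usphere: "x \<in> usphere \<Longrightarrow> y \<in> usphere \<Longrightarrow> -1 \<le> x \<bullet> y \<and> x \<bullet> y \<le> (1::real)"
  using inner_usphere_abs_le[of x y] by (simp add: abs_le_iff)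

lemma mem_Sigma_fst_snd: "p \<in> A \<times> B \<Longrightarrow> fst p \<in> A \<and> snd p \<in> B"
  by auto

lemma continuous2_cost: "continuous2 cost"
  unfolding cost_def geodesic_dist_def
  by (intro continuous_intros ballI; drule mem_Sigma_fst_snd)
     (simp_all only: inner_usphere)

lemma cost_commute: "cost x y = cost y x"
  by (simp add: cost_def geodesic_dist_def inner_commute)

lemma cost_bounds:
  assumes "x \<in> usphere" "y \<in> usphere"
  shows "0 \<le> cost x y" "cost x y \<le> pi\<^sup>2 / 2"
proof -
  show "0 \<le> cost x y" by (simp add: cost_def)
  show "cost x y \<le> pi\<^sup>2 / 2"
    using inner_usphere[OF assms] unfolding cost_def geodesic_dist_def
    by (intro divide_right_mono power_mono arccos_ubound arccos_lbound) auto
qed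

text \<open>
  The \<open>c\<close>-conjugate \<open>min_y c(x, y) - \<psi>(y)\<close>. Since the cost is symmetric, the same operator
  conjugates potentials on either side.
\<close>

definition conjugate :: "('a::euclidean_space \<Rightarrow> real) \<Rightarrow> 'a \<Rightarrow> real" where
  "conjugate \<psi> x = - fibre_max (\<lambda>x y. \<psi> y - cost x y) x"

context
  fixes \<psi> :: "'a::euclidean_space \<Rightarrow> real"
  assumes \<psi>: "continuous_on usphere \<psi>"
begin

lemma continuous2_conjugate_arg: "continuous2 (\<lambda>x y. \<psi> y - cost x y)"
  by (intro continuous_intros continuous2_one_variable \<psi> continuous2_cost)

lemma conjugate_le: "x \<in> usphere \<Longrightarrow> y \<in> usphere \<Longrightarrow> conjugate \<psi> x + \<psi> y \<le> cost x y"
  using fibre_max_upper[OF continuous2_conjugate_arg, of x y] by (simp add: conjugate_def)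

lemma conjugate_attained:
  assumes "x \<in> usphere"
  obtains y where "y \<in> usphere" "conjugate \<psi> x + \<psi> y = cost x y"
proof -
  obtain y where "y \<in> usphere" "fibre_max (\<lambda>x y. \<psi> y - cost x y) x = \<psi> y - cost x y"
    using fibre_max_attained[OF continuous2_conjugate_arg assms] by blast
  then show ?thesis using that[of y] by (simp add: conjugate_def)
qed

lemma conjugate_greatest:
  assumes "x \<in> usphere" "\<And>y. y \<in> usphere \<Longrightarrow> b + \<psi> y \<le> cost x y"
  shows "b \<le> conjugate \<psi> x"
proof -
  obtain y where "y \<in> usphere" "conjugate \<psi> x + \<psi> y = cost x y"
    using conjugate_attained[OF assms(1)] by blast
  with assms(2)[of y] show ?thesis by linarith
qed

lemma continuous_conjugate: "continuous_on usphere (conjugate \<psi>)"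
  unfolding conjugate_def
  by (intro continuous_intros continuous_fibre_max continuous2_conjugate_arg)

end

lemma conjugate_le_conjugate:
  assumes "continuous_on usphere \<psi>" "continuous_on usphere \<psi>'" "x \<in> usphere"
    and "\<And>y. y \<in> usphere \<Longrightarrow> \<psi> y \<le> \<psi>' y + e"
  shows "conjugate \<psi>' x \<le> conjugate \<psi> x + e"
proof -
  obtain y where "y \<in> usphere" "conjugate \<psi> x + \<psi> y = cost x y"
    using conjugate_attained[OF assms(1,3)] by blast
  with conjugate_le[OF assms(2,3), of y] assms(4)[of y] show ?thesis by linarith
qed

lemma conjugate_conjugate_ge:
  assumes "continuous_on usphere \<psi>" "y \<in> usphere"
  shows "\<psi> y \<le> conjugate (conjugate \<psi>) y"
  by (rule conjugate_greatest[OF continuous_conjugate[OF assms(1)] assms(2)])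
     (use conjugate_le[OF assms(1) _ assms(2)] in \<open>simp add: cost_commute[of y] add.commute\<close>)

text \<open>
  Potentials that vary at most as much as the cost does. They have a common modulus of
  continuity, so up to additive constants they form a compact family; both conjugates and the
  potentials of a finite assignment problem belong to it.
\<close>

definition cost_modulus :: "('a::euclidean_space \<Rightarrow> real) \<Rightarrow> bool" where
  "cost_modulus \<psi> \<longleftrightarrow>
     (\<forall>x\<in>usphere. \<forall>x'\<in>usphere. \<exists>y\<in>usphere. \<psi> x - \<psi> x' \<le> cost x y - cost x' y)"

lemma cost_modulus_conjugate:
  assumes \<psi>: "continuous_on usphere \<psi>"
  shows "cost_modulus (conjugate \<psi>)"
  unfolding cost_modulus_def
proof (intro ballI)
  fix x x' :: 'a assume x: "x \<in> usphere" "x' \<in> usphere"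
  obtain y where "y \<in> usphere" "conjugate \<psi> x' + \<psi> y = cost x' y"
    using conjugate_attained[OF \<psi> x(2)] by blast
  then show "\<exists>y\<in>usphere. conjugate \<psi> x - conjugate \<psi> x' \<le> cost x y - cost x' y"
    using conjugate_le[OF \<psi> x(1)] by (intro bexI[of _ y]) force+
qed

lemma cost_modulus_equicontinuous:
  assumes "0 < e"
  obtains d where "0 < d" "\<And>(\<psi> :: 'a::euclidean_space \<Rightarrow> real) x x'. cost_modulus \<psi> \<Longrightarrow>
    x \<in> usphere \<Longrightarrow> x' \<in> usphere \<Longrightarrow> norm (x - x') < d \<Longrightarrow> \<bar>\<psi> x - \<psi> x'\<bar> < e"
proof -
  obtain d where d: "0 < d" "\<And>x x' y :: 'a. x \<in> usphere \<Longrightarrow> x' \<in> usphere \<Longrightarrow> y \<in> usphere \<Longrightarrow>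
      norm (x - x') < d \<Longrightarrow> \<bar>cost x y - cost x' y\<bar> < e"
    by (rule continuous2_uniform[OF continuous2_cost assms]) (rule that)
  have *: "\<psi> x - \<psi> x' < e"
    if \<psi>: "cost_modulus \<psi>" and x: "x \<in> usphere" "x' \<in> usphere" "norm (x - x') < d"
    for \<psi> and x x' :: 'a
  proof -
    obtain y where "y \<in> usphere" "\<psi> x - \<psi> x' \<le> cost x y - cost x' y"
      using \<psi> x unfolding cost_modulus_def by blast
    with d(2)[OF x(1,2) _ x(3), of y] show ?thesis by linarith
  qed
  show ?thesis
  proof (rule that[OF d(1)])
    fix \<psi> :: "'a \<Rightarrow> real" and x x' :: 'a
    assume "cost_modulus \<psi>" "x \<in> usphere" "x' \<in> usphere" "norm (x - x') < d"
    with *[of \<psi> x x'] *[of \<psi> x' x] show "\<bar>\<psi> x - \<psi> x'\<bar> < e"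
      by (simp add: norm_minus_commute abs_less_iff)
  qed
qed

lemma cost_modulus_continuous:
  assumes "cost_modulus \<psi>"
  shows "continuous_on usphere \<psi>"
proof -
  have "\<exists>d>0. \<forall>x'\<in>usphere. norm (x' - x) < d \<longrightarrow> \<bar>\<psi> x' - \<psi> x\<bar> < e"
    if x: "x \<in> usphere" and e: "0 < e" for x e
  proof -
    obtain d where d: "0 < d" "\<And>(\<psi> :: 'a \<Rightarrow> real) x x'. cost_modulus \<psi> \<Longrightarrow>
        x \<in> usphere \<Longrightarrow> x' \<in> usphere \<Longrightarrow> norm (x - x') < d \<Longrightarrow> \<bar>\<psi> x - \<psi> x'\<bar> < e"
      by (rule cost_modulus_equicontinuous[OF e]) (rule that)
    show ?thesis
      using d(1) d(2)[OF assms _ x] by (intro exI[of _ d]) simp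
  qed
  then show ?thesis by (simp add: continuous_on_iff dist_norm)
qed

lemma cost_modulus_oscillation:
  assumes "cost_modulus \<psi>" "x \<in> usphere" "x' \<in> usphere"
  shows "\<bar>\<psi> x - \<psi> x'\<bar> \<le> pi\<^sup>2 / 2"
proof -
  have "\<psi> x - \<psi> x' \<le> pi\<^sup>2 / 2" if x: "x \<in> usphere" "x' \<in> usphere" for x x'
  proof -
    obtain y where "y \<in> usphere" "\<psi> x - \<psi> x' \<le> cost x y - cost x' y"
      using assms(1) x unfolding cost_modulus_def by blast
    then show ?thesis using cost_bounds(1)[OF x(2), of y] cost_bounds(2)[OF x(1), of y] by linarith
  qed
  from this[OF assms(2,3)] this[OF assms(3,2)] show ?thesis by linarith
qed

text \<open>Arzela--Ascoli, with the additive constants removed by prescribing the value at \<open>x0\<close>.\<close>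

lemma cost_modulus_subsequence:
  fixes \<Psi> :: "nat \<Rightarrow> 'a::euclidean_space \<Rightarrow> real"
  assumes mod: "\<And>n. cost_modulus (\<Psi> n)" and x0: "x0 \<in> usphere" "\<And>n. \<Psi> n x0 = 0"
  obtains g r where "continuous_on usphere g" "strict_mono (r :: nat \<Rightarrow> nat)"
    "\<And>e. 0 < e \<Longrightarrow> \<exists>N. \<forall>n x. n \<ge> N \<and> x \<in> usphere \<longrightarrow> \<bar>\<Psi> (r n) x - g x\<bar> < e"
proof -
  have bound: "norm (\<Psi> n x) \<le> pi\<^sup>2 / 2" if "x \<in> usphere" for n x
    using cost_modulus_oscillation[OF mod that x0(1)] x0(2) by simp
  have equi: "\<exists>d. 0 < d \<and> (\<forall>n y. y \<in> usphere \<and> norm (x - y) < d \<longrightarrow> norm (\<Psi> n x - \<Psi> n y) < e)"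
    if "x \<in> usphere" "0 < e" for x e
  proof -
    obtain d where d: "0 < d" "\<And>(\<psi> :: 'a \<Rightarrow> real) x x'. cost_modulus \<psi> \<Longrightarrow>
        x \<in> usphere \<Longrightarrow> x' \<in> usphere \<Longrightarrow> norm (x - x') < d \<Longrightarrow> \<bar>\<psi> x - \<psi> x'\<bar> < e"
      by (rule cost_modulus_equicontinuous[OF \<open>0 < e\<close>]) (rule that)
    show ?thesis
      using d(1) d(2)[OF mod \<open>x \<in> usphere\<close>] by (intro exI[of _ d]) simp
  qed
  obtain g r where "continuous_on usphere g" "strict_mono (r :: nat \<Rightarrow> nat)"
    "\<And>e. 0 < e \<Longrightarrow> \<exists>N. \<forall>n x. n \<ge> N \<and> x \<in> usphere \<longrightarrow> norm (\<Psi> (r n) x - g x) < e"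
    by (rule Arzela_Ascoli[of usphere \<Psi> "pi\<^sup>2 / 2", OF compact_sphere bound equi])
       (assumption | rule that)+
  then show ?thesis unfolding real_norm_def by (rule that)
qed

text \<open>
  Without a finite net one could choose successively a sequence of potentials whose uniform
  distances are all at least \<open>e\<close>, and no subsequence would converge.
\<close>

lemma cost_modulus_finite_net:
  fixes x0 :: "'a::euclidean_space"
  assumes e: "0 < e" and x0: "x0 \<in> usphere"
  obtains H where "finite H" "\<And>h. h \<in> H \<Longrightarrow> continuous_on usphere h"
    "\<And>\<psi>. cost_modulus \<psi> \<Longrightarrow> \<psi> x0 = 0 \<Longrightarrow> \<exists>h\<in>H. \<forall>x\<in>usphere. \<bar>\<psi> x - h x\<bar> < e"
proof -
  define E where "E = {\<psi> :: 'a \<Rightarrow> real. cost_modulus \<psi> \<and> \<psi> x0 = 0}"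
  have "\<exists>H. finite H \<and> H \<subseteq> E \<and> (\<forall>\<psi>\<in>E. \<exists>h\<in>H. \<forall>x\<in>usphere. \<bar>\<psi> x - h x\<bar> < e)"
  proof (rule ccontr)
    assume no_net: "\<not> ?thesis"
    have "\<exists>\<psi>\<in>E. \<forall>h\<in>H. \<exists>x\<in>usphere. e \<le> \<bar>\<psi> x - h x\<bar>" if "finite H" "H \<subseteq> E" for H
      using no_net that by (metis not_less)
    then have ex: "\<exists>\<psi>. \<psi> \<in> E \<and> (\<forall>h\<in>H. \<exists>x\<in>usphere. e \<le> \<bar>\<psi> x - h x\<bar>)"
      if "finite H" "H \<subseteq> E" for H using that by blast
    define pick where "pick H = (SOME \<psi>. \<psi> \<in> E \<and> (\<forall>h\<in>H. \<exists>x\<in>usphere. e \<le> \<bar>\<psi> x - h x\<bar>))" for H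
    have pick: "pick H \<in> E" "\<forall>h\<in>H. \<exists>x\<in>usphere. e \<le> \<bar>pick H x - h x\<bar>"
      if "finite H" "H \<subseteq> E" for H
      using someI_ex[OF ex[OF that]] unfolding pick_def by blast+
    define Hs where "Hs = rec_nat {} (\<lambda>_ H. insert (pick H) H)"
    have Hs: "Hs 0 = {}" "\<And>n. Hs (Suc n) = insert (pick (Hs n)) (Hs n)"
      by (auto simp: Hs_def)
    have fin: "finite (Hs n) \<and> Hs n \<subseteq> E" for n
      by (induction n) (use pick(1) in \<open>auto simp: Hs\<close>)
    have mono: "m \<le> n \<Longrightarrow> Hs m \<subseteq> Hs n" for m n
      by (rule lift_Suc_mono_le[of Hs]) (auto simp: Hs)
    define \<Psi> where "\<Psi> n = pick (Hs n)" for n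
    have sep: "\<exists>x\<in>usphere. e \<le> \<bar>\<Psi> n x - \<Psi> m x\<bar>" if "m < n" for m n
    proof -
      have "\<Psi> m \<in> Hs n" using mono[of "Suc m" n] that Hs(2)[of m] unfolding \<Psi>_def by auto
      with pick(2)[of "Hs n"] fin[of n] show ?thesis unfolding \<Psi>_def by blast
    qed
    have "\<Psi> n \<in> E" for n using pick(1)[of "Hs n"] fin[of n] unfolding \<Psi>_def by blast
    then have \<Psi>: "cost_modulus (\<Psi> n)" "\<Psi> n x0 = 0" for n unfolding E_def by blast+
    obtain g r where "continuous_on usphere g" and r: "strict_mono (r :: nat \<Rightarrow> nat)"
      "\<And>e. 0 < e \<Longrightarrow> \<exists>N. \<forall>n x. n \<ge> N \<and> x \<in> usphere \<longrightarrow> \<bar>\<Psi> (r n) x - g x\<bar> < e"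
      by (rule cost_modulus_subsequence[of \<Psi> x0, OF \<Psi>(1) x0 \<Psi>(2)]) (rule that)
    obtain N where N: "\<And>n x. n \<ge> N \<Longrightarrow> x \<in> usphere \<Longrightarrow> \<bar>\<Psi> (r n) x - g x\<bar> < e/2"
      using r(2)[OF half_gt_zero[OF e]] by auto
    have "r N < r (Suc N)" using r(1) by (simp add: strict_mono_def)
    then obtain x where "x \<in> usphere" "e \<le> \<bar>\<Psi> (r (Suc N)) x - \<Psi> (r N) x\<bar>"
      using sep by blast
    with N[of N x] N[of "Suc N" x] show False by linarith
  qed
  then obtain H where "finite H" "H \<subseteq> E" "\<forall>\<psi>\<in>E. \<exists>h\<in>H. \<forall>x\<in>usphere. \<bar>\<psi> x - h x\<bar> < e" by blast
  then show ?thesis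
    using that[of H] cost_modulus_continuous unfolding E_def by blast
qed

section \<open>Points with two optimal partners form a null set\<close>

text \<open>
  The translates by \<open>q v, q v / 2, q v / 3, \<dots>\<close> are disjoint, and a bounded region cannot contain
  infinitely many disjoint translates of a set of positive measure.
\<close>

lemma null_of_disjoint_translates:
  fixes A :: "'a::euclidean_space set"
  assumes A: "A \<in> sets borel" and q: "0 < q"
    and disj: "\<And>x s. x \<in> A \<Longrightarrow> s \<noteq> 0 \<Longrightarrow> \<bar>s\<bar> \<le> q \<Longrightarrow> x + s *\<^sub>R v \<notin> A"
  shows "A \<in> null_sets lborel"
proof -
  have bounded: "A \<inter> cball 0 R \<in> null_sets lborel" for R :: real
  proof -
    define B where "B = A \<inter> cball 0 R"
    define s where "s i = q / real (Suc i)" for i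
    define T where "T i = (+) (- s i *\<^sub>R v) -` B" for i
    have B: "B \<in> sets borel" unfolding B_def using A by simp
    have T_sets: "T i \<in> sets borel" for i
      unfolding T_def using measurable_sets[of "(+) (- s i *\<^sub>R v)" borel borel B] B by simp
    have T_emeasure: "emeasure lborel (T i) = emeasure lborel B" for i
    proof -
      have "emeasure lborel B = emeasure (distr lborel borel ((+) (- s i *\<^sub>R v))) B"
        by (simp add: lborel_distr_plus)
      also have "\<dots> = emeasure lborel (T i)"
        by (subst emeasure_distr) (auto simp: T_def B)
      finally show ?thesis by simp
    qed
    have s: "0 < s i" "s i \<le> q" for i
      using q by (auto simp: s_def field_simps)
    have s_inj: "s i \<noteq> s j" if "i \<noteq> j" for i j
      using that q by (auto simp: s_def field_simps)
    have "disjoint_family T"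
      unfolding disjoint_family_on_def
    proof (intro ballI impI, rule ccontr)
      fix i j :: nat assume "i \<noteq> j" "T i \<inter> T j \<noteq> {}"
      then obtain x where x: "- s i *\<^sub>R v + x \<in> A" "- s j *\<^sub>R v + x \<in> A" by (auto simp: T_def B_def)
      have "- s j *\<^sub>R v + x = (- s i *\<^sub>R v + x) + (s i - s j) *\<^sub>R v" by (simp add: algebra_simps)
      moreover have "\<bar>s i - s j\<bar> \<le> q" using s[of i] s[of j] by auto
      ultimately show False
        using disj[OF x(1), of "s i - s j"] x(2) s_inj[OF \<open>i \<noteq> j\<close>] by (metis right_minus_eq)
    qed
    have "(\<Union>i. T i) \<subseteq> cball 0 (R + q * norm v)"
    proof
      fix x assume "x \<in> (\<Union>i. T i)"
      then obtain i where "norm (- s i *\<^sub>R v + x) \<le> R" by (auto simp: T_def B_def)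
      moreover have "norm x \<le> norm (- s i *\<^sub>R v + x) + norm (s i *\<^sub>R v)"
        using norm_triangle_ineq[of "- s i *\<^sub>R v + x" "s i *\<^sub>R v"] by simp
      moreover have "norm (s i *\<^sub>R v) \<le> q * norm v"
        using s[of i] by (simp add: mult_right_mono)
      ultimately show "x \<in> cball 0 (R + q * norm v)" by simp
    qed
    then have "emeasure lborel (\<Union>i. T i) \<le> emeasure lborel (cball (0::'a) (R + q * norm v))"
      by (intro emeasure_mono) auto
    also have "\<dots> < \<infinity>" by (rule emeasure_lborel_cball_finite)
    finally have fin: "(\<Sum>i. emeasure lborel B) < \<infinity>"
      using suminf_emeasure[of T lborel] T_sets \<open>disjoint_family T\<close> by (simp add: T_emeasure image_subset_iff)
    have "emeasure lborel B \<le> emeasure lborel (cball (0::'a) R)"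
      unfolding B_def by (intro emeasure_mono) auto
    also have "\<dots> < \<infinity>" by (rule emeasure_lborel_cball_finite)
    finally have "emeasure lborel B = ennreal (measure lborel B)"
      by (simp add: emeasure_eq_ennreal_measure)
    with fin have "summable (\<lambda>i::nat. measure lborel B)"
      by (intro summable_suminf_not_top) auto
    then have "measure lborel B = 0" by (simp add: summable_const_iff)
    with \<open>emeasure lborel B = ennreal (measure lborel B)\<close> B show ?thesis
      by (auto simp: B_def)
  qed
  have "A = (\<Union>n::nat. A \<inter> cball 0 (real n))"
    using real_arch_simple by auto
  then show ?thesis
    using null_sets_UN[of "\<lambda>n::nat. A \<inter> cball 0 (real n)" lborel] bounded by simp
qed

text \<open>
  Points at which \<open>\<Phi>\<close> has a concave corner in the direction \<open>v\<close>: after subtracting the slope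
  \<open>r\<close>, the restriction of \<open>\<Phi>\<close> to the line has a strict local maximum with linear decay on an
  interval of radius \<open>\<delta>\<close>. Two such maxima cannot be closer than \<open>\<delta>\<close> on one line, and the
  quantitative form keeps the set closed. The bound on the norm keeps the line segment away
  from the origin, where the functions of interest are discontinuous.
\<close>

definition corners :: "('a::euclidean_space \<Rightarrow> real) \<Rightarrow> 'a \<Rightarrow> real \<Rightarrow> real \<Rightarrow> 'a set" where
  "corners \<Phi> v r \<delta> =
     {x. 2 * \<delta> \<le> norm x \<and> (\<forall>s. \<bar>s\<bar> \<le> \<delta> \<longrightarrow> \<Phi> (x + s *\<^sub>R v) \<le> \<Phi> x + r * s - \<delta> * \<bar>s\<bar>)}"

lemma cornersD:
  "x \<in> corners \<Phi> v r \<delta> \<Longrightarrow> \<bar>s\<bar> \<le> \<delta> \<Longrightarrow> \<Phi> (x + s *\<^sub>R v) \<le> \<Phi> x + r * s - \<delta> * \<bar>s\<bar>"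
  by (simp only: corners_def mem_Collect_eq)

lemma corners_null:
  fixes \<Phi> :: "'a::euclidean_space \<Rightarrow> real"
  assumes \<Phi>: "continuous_on (- {0}) \<Phi>" and v: "norm v = 1" and \<delta>: "0 < \<delta>"
  shows "corners \<Phi> v r \<delta> \<in> null_sets lborel"
proof -
  define C where "C s = {x\<in>{x. 2 * \<delta> \<le> norm x}. \<Phi> (x + s *\<^sub>R v) \<le> \<Phi> x + r * s - \<delta> * \<bar>s\<bar>}" for s
  have "closed (C s)" if "\<bar>s\<bar> \<le> \<delta>" for s
    unfolding C_def
  proof (rule continuous_on_closed_Collect_le)
    have "x + s *\<^sub>R v \<noteq> 0" if "2 * \<delta> \<le> norm x" for x
      using norm_triangle_ineq2[of x "- s *\<^sub>R v"] that \<open>\<bar>s\<bar> \<le> \<delta>\<close> v \<delta> by auto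
    then show "continuous_on {x. 2 * \<delta> \<le> norm x} (\<lambda>x. \<Phi> (x + s *\<^sub>R v))"
      by (intro continuous_on_compose2[OF \<Phi>] continuous_intros) auto
    show "continuous_on {x. 2 * \<delta> \<le> norm x} (\<lambda>x. \<Phi> x + r * s - \<delta> * \<bar>s\<bar>)"
      by (intro continuous_intros continuous_on_subset[OF \<Phi>]) (use \<delta> in auto)
    show "closed {x::'a. 2 * \<delta> \<le> norm x}"
      by (intro closed_Collect_le continuous_intros)
  qed
  then have "closed (\<Inter>s\<in>{-\<delta>..\<delta>}. C s)" by (intro closed_INT) auto
  also have "(\<Inter>s\<in>{-\<delta>..\<delta>}. C s) = corners \<Phi> v r \<delta>"
  proof -
    have "(0::real) \<in> {-\<delta>..\<delta>}" using \<delta> by simp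
    then show ?thesis unfolding C_def corners_def by (fastforce simp: abs_le_iff)
  qed
  finally have "corners \<Phi> v r \<delta> \<in> sets borel" by (rule borel_closed)
  then show ?thesis
  proof (rule null_of_disjoint_translates[OF _ \<delta>])
    fix x s assume x: "x \<in> corners \<Phi> v r \<delta>" and s: "s \<noteq> 0" "\<bar>s\<bar> \<le> \<delta>"
    show "x + s *\<^sub>R v \<notin> corners \<Phi> v r \<delta>"
    proof
      assume x': "x + s *\<^sub>R v \<in> corners \<Phi> v r \<delta>"
      have "\<Phi> (x + s *\<^sub>R v) \<le> \<Phi> x + r * s - \<delta> * \<bar>s\<bar>"
        using x s(2) by (rule cornersD)
      moreover have "\<Phi> (x + s *\<^sub>R v + (- s) *\<^sub>R v) \<le> \<Phi> (x + s *\<^sub>R v) + r * (- s) - \<delta> * \<bar>- s\<bar>"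
        using x' by (rule cornersD) (use s in simp)
      moreover have "0 < \<delta> * \<bar>s\<bar>" using \<delta> s by simp
      ultimately show False by simp
    qed
  qed
qed

text \<open>
  A rational slope strictly between \<open>a\<close> and \<open>b\<close> leaves a linear gap on either side, and rational
  slopes and radii \<open>1 / m\<close> make the family of corner sets countable.
\<close>

lemma mem_corners:
  assumes x: "x \<noteq> 0" and ab: "a < b"
    and right: "\<And>e. 0 < e \<Longrightarrow> \<exists>d>0. \<forall>s. 0 < s \<and> s < d \<longrightarrow> \<Phi> (x + s *\<^sub>R v) - \<Phi> x \<le> (a + e) * s"
    and left: "\<And>e. 0 < e \<Longrightarrow> \<exists>d>0. \<forall>s. - d < s \<and> s < 0 \<longrightarrow> \<Phi> (x + s *\<^sub>R v) - \<Phi> x \<le> (b - e) * s"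
  shows "\<exists>r\<in>\<rat>. \<exists>m::nat. x \<in> corners \<Phi> v r (1 / Suc m)"
proof -
  obtain r where r: "r \<in> \<rat>" "a < r" "r < b" using Rats_dense_in_real[OF ab] by blast
  define e where "e = min (r - a) (b - r) / 2"
  have e: "0 < e" "a + e \<le> r - e" "r + e \<le> b - e"
    using r by (auto simp: e_def min_def field_simps)
  obtain d1 where d1: "0 < d1" "\<And>s. 0 < s \<Longrightarrow> s < d1 \<Longrightarrow> \<Phi> (x + s *\<^sub>R v) - \<Phi> x \<le> (a + e) * s"
    using right[OF e(1)] by blast
  obtain d2 where d2: "0 < d2" "\<And>s. - d2 < s \<Longrightarrow> s < 0 \<Longrightarrow> \<Phi> (x + s *\<^sub>R v) - \<Phi> x \<le> (b - e) * s"
    using left[OF e(1)] by blast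
  obtain m where "1 / real (Suc m) < min (min d1 d2) (min e (norm x / 2))"
    using d1(1) d2(1) e(1) x nat_approx_posE[of "min (min d1 d2) (min e (norm x / 2))"] by auto
  then have m: "1 / Suc m < d1" "1 / Suc m < d2" "1 / Suc m < e" "2 * (1 / Suc m) \<le> norm x"
    by auto
  have "\<Phi> (x + s *\<^sub>R v) \<le> \<Phi> x + r * s - 1 / Suc m * \<bar>s\<bar>" if s: "\<bar>s\<bar> \<le> 1 / Suc m" for s
  proof -
    have e': "1 / Suc m * \<bar>s\<bar> \<le> e * \<bar>s\<bar>" using m(3) by (intro mult_right_mono) auto
    consider "s = 0" | "0 < s" | "s < 0" by linarith
    then show ?thesis
    proof cases
      case 2
      have "\<Phi> (x + s *\<^sub>R v) - \<Phi> x \<le> (a + e) * s" using s 2 m by (intro d1(2)) auto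
      also have "\<dots> \<le> (r - e) * s" using 2 e by (intro mult_right_mono) auto
      also have "\<dots> = r * s - e * \<bar>s\<bar>" using 2 by (simp add: algebra_simps)
      finally show ?thesis using e' by linarith
    next
      case 3
      have "\<Phi> (x + s *\<^sub>R v) - \<Phi> x \<le> (b - e) * s" using s 3 m by (intro d2(2)) auto
      also have "\<dots> \<le> (r + e) * s" using 3 e by (intro mult_right_mono_neg) auto
      also have "\<dots> = r * s - e * \<bar>s\<bar>" using 3 by (simp add: algebra_simps)
      finally show ?thesis using e' by linarith
    qed simp
  qed
  then show ?thesis using r(1) m(4) by (auto simp: corners_def intro!: bexI[of _ r] exI[of _ m])
qed

lemma inner_self_usphere: "x \<in> usphere \<Longrightarrow> x \<bullet> x = (1::real)"
  by (simp add: dot_square_norm)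

lemma sgn_usphere: "x \<noteq> 0 \<Longrightarrow> sgn x \<in> (usphere :: 'a::euclidean_space set)"
  by (simp add: norm_sgn)

lemma arccos_square_le:
  assumes "0 \<le> t" "t \<le> 1"
  shows "(arccos t)\<^sup>2 \<le> 4 * (1 - t)"
proof -
  define h where "h = arccos t / 2"
  have th: "0 \<le> arccos t" "arccos t \<le> pi / 2"
    using assms arccos_lbound[of t] arccos_le_pi2[of t] by auto
  then have h: "0 \<le> h" "h < pi / 2" unfolding h_def using pi_gt_zero by linarith+
  have t: "t = cos (2 * h)" using assms by (simp add: h_def)
  have ch: "0 < cos h" using h by (intro cos_gt_zero_pi) auto
  have "h = arctan (tan h)" using h by (intro arctan_tan[symmetric]) auto
  also have "\<dots> \<le> tan h" using h by (intro arctan_le_self) (cases "h = 0"; auto intro!: less_imp_le tan_gt_zero)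
  finally have "h * cos h \<le> sin h" using ch by (simp add: tan_def field_simps)
  then have "(h * cos h)\<^sup>2 \<le> (sin h)\<^sup>2" using h ch by (intro power_mono) auto
  also have "(sin h)\<^sup>2 = (1 - t) / 2" unfolding t cos_double_sin by simp
  finally have 1: "h\<^sup>2 * (cos h)\<^sup>2 \<le> (1 - t) / 2" by (simp add: power_mult_distrib)
  have "(cos h)\<^sup>2 = (1 + t) / 2" unfolding t cos_double_cos by simp
  then have "h\<^sup>2 * (1 / 2) \<le> h\<^sup>2 * (cos h)\<^sup>2" using assms by (intro mult_left_mono) auto
  with 1 show ?thesis by (simp add: h_def power_divide)
qed

lemma chord_le_arccos:
  assumes "x \<in> usphere" "y \<in> usphere"
  shows "norm (x - y) \<le> arccos (x \<bullet> y)"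
proof -
  define h where "h = arccos (x \<bullet> y) / 2"
  have b: "-1 \<le> x \<bullet> y" "x \<bullet> y \<le> 1" using inner_usphere_abs_le[OF assms] by auto
  have h: "0 \<le> h" using arccos_lbound[OF b] by (simp add: h_def)
  have "(norm (x - y))\<^sup>2 = 2 - 2 * (x \<bullet> y)"
    using assms dot_norm_neg[of x y] by simp
  also have "x \<bullet> y = cos (2 * h)" using b by (simp add: h_def)
  also have "2 - 2 * cos (2 * h) = 4 * (sin h)\<^sup>2" unfolding cos_double_sin by simp
  also have "\<dots> \<le> (2 * h)\<^sup>2"
    using abs_sin_x_le_abs_x[of h] by (simp add: power_mult_distrib abs_le_square_iff)
  finally show ?thesis
    using h by (auto simp: h_def intro: power2_le_imp_le)
qed

text \<open>
  Minus the spherical gradient of \<open>cost u y\<close> in \<open>u\<close>, i.e. the initial velocity of the geodesic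
  from \<open>u\<close> to \<open>y\<close>. The value \<open>0\<close> of division by zero is correct at \<open>y = u\<close>.
\<close>

definition log_map :: "'a::euclidean_space \<Rightarrow> 'a \<Rightarrow> 'a" where
  "log_map u y = (arccos (u \<bullet> y) / sqrt (1 - (u \<bullet> y)\<^sup>2)) *\<^sub>R (y - (u \<bullet> y) *\<^sub>R u)"

lemma usphere_eqI: "u \<in> usphere \<Longrightarrow> y \<in> usphere \<Longrightarrow> u \<bullet> y = (1::real) \<Longrightarrow> u = y"
  using dot_norm_neg[of u y] by simp

lemma usphere_antipodeI: "u \<in> usphere \<Longrightarrow> y \<in> usphere \<Longrightarrow> u \<bullet> y = (-1::real) \<Longrightarrow> y = - u"
  using usphere_eqI[of "-u" y] by simp

lemma log_map_inj:
  assumes u: "u \<in> usphere" and y: "y \<in> usphere" "y \<noteq> - u" and y': "y' \<in> usphere" "y' \<noteq> - u"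
    and eq: "log_map u y = log_map u y'"
  shows "y = y'"
proof -
  have norm_log: "norm (log_map u y) = arccos (u \<bullet> y)" if y: "y \<in> usphere" "y \<noteq> - u" for y
  proof (cases "u \<bullet> y = 1")
    case True then show ?thesis by (simp add: log_map_def)
  next
    case False
    then have t: "-1 < u \<bullet> y" "u \<bullet> y < 1"
      using inner_usphere_abs_le[OF u y(1)] usphere_antipodeI[OF u y(1)] y(2)
      by (auto simp: abs_le_iff less_le)
    have "(norm (y - (u \<bullet> y) *\<^sub>R u))\<^sup>2 = 1 - (u \<bullet> y)\<^sup>2"
      using inner_self_usphere[OF u] inner_self_usphere[OF y(1)]
      unfolding power2_norm_eq_inner
      by (simp add: inner_diff inner_commute[of y u] power2_eq_square)
    then have n: "norm (y - (u \<bullet> y) *\<^sub>R u) = sqrt (1 - (u \<bullet> y)\<^sup>2)"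
      by (metis norm_ge_zero real_sqrt_unique)
    have "(u \<bullet> y)\<^sup>2 < 1" using t by (simp add: abs_square_less_1)
    then have "sqrt (1 - (u \<bullet> y)\<^sup>2) > 0" by simp
    then show ?thesis
      using arccos_lbound[of "u \<bullet> y"] t by (simp add: log_map_def n)
  qed
  have ac: "arccos (u \<bullet> y) = arccos (u \<bullet> y')"
    using norm_log[OF y] norm_log[OF y'] eq by simp
  have "\<bar>u \<bullet> y\<bar> \<le> 1" "\<bar>u \<bullet> y'\<bar> \<le> 1"
    using inner_usphere_abs_le[OF u] y(1) y'(1) by blast+
  with ac have t: "u \<bullet> y = u \<bullet> y'"
    by (metis cos_arccos_abs)
  show ?thesis
  proof (cases "u \<bullet> y = 1")
    case True
    then show ?thesis using usphere_eqI[OF u y(1)] usphere_eqI[OF u y'(1)] t by simp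
  next
    case False
    then have "-1 < u \<bullet> y" "u \<bullet> y < 1"
      using inner_usphere_abs_le[OF u y(1)] usphere_antipodeI[OF u y(1)] y(2)
      by (auto simp: abs_le_iff less_le)
    then have "arccos (u \<bullet> y) > 0" "(u \<bullet> y)\<^sup>2 < 1"
      using arccos_lt_bounded[of "u \<bullet> y"] by (auto simp: abs_square_less_1)
    then have "arccos (u \<bullet> y) / sqrt (1 - (u \<bullet> y)\<^sup>2) \<noteq> 0" by simp
    then show ?thesis using eq unfolding log_map_def t[symmetric] by simp
  qed
qed

text \<open>
  Along a line the direction \<open>sgn x\<close> moves with the tangential part of the velocity, scaled by
  \<open>1 / norm x\<close>. At \<open>y = sgn x\<close> the geodesic distance is not differentiable, but its square vanishes
  to second order there.
\<close>

lemma cost_line_derivative: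
  fixes x y v :: "'a::euclidean_space"
  assumes x: "x \<noteq> 0" and y: "y \<in> usphere" "y \<noteq> - sgn x"
  shows "((\<lambda>s. cost (sgn (x + s *\<^sub>R v)) y) has_real_derivative - (log_map (sgn x) y \<bullet> v) / norm x) (at 0)"
proof -
  define p where "p s = sgn (x + s *\<^sub>R v) \<bullet> y" for s
  define u where "u = sgn x"
  define t where "t = u \<bullet> y"
  have u: "u \<in> usphere" using x by (simp add: u_def norm_sgn)
  have nx: "0 < norm x" using x by simp
  have x_eq: "x = norm x *\<^sub>R u" using x by (simp add: u_def sgn_div_norm)
  have p_eq: "p s = (x \<bullet> y + s * (v \<bullet> y)) / sqrt (x \<bullet> x + 2 * s * (x \<bullet> v) + s\<^sup>2 * (v \<bullet> v))" for s
  proof -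
    have "norm (x + s *\<^sub>R v) = sqrt (x \<bullet> x + 2 * s * (x \<bullet> v) + s\<^sup>2 * (v \<bullet> v))"
      by (simp add: norm_eq_sqrt_inner inner_add_left inner_add_right inner_commute[of v x] power2_eq_square distrib_left)
    then show ?thesis
      by (simp add: p_def sgn_div_norm inner_add_left divide_inverse mult.commute)
  qed
  have sq: "sqrt (x \<bullet> x) = norm x" by (simp add: norm_eq_sqrt_inner)
  define n where "n s = x \<bullet> x + 2 * s * (x \<bullet> v) + s\<^sup>2 * (v \<bullet> v)" for s
  have n0: "n 0 = x \<bullet> x" by (simp add: n_def)
  have p_eq': "p = (\<lambda>s. (x \<bullet> y + s * (v \<bullet> y)) / sqrt (n s))"
    by (rule ext) (simp add: p_eq n_def)
  have "(n has_real_derivative 2 * (x \<bullet> v)) (at 0)"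
    unfolding n_def[abs_def] by (auto intro!: derivative_eq_intros)
  moreover have "(sqrt has_real_derivative inverse (sqrt (n 0)) / 2) (at (n 0))"
    using x by (intro DERIV_real_sqrt) (simp add: n0)
  ultimately have "((\<lambda>s. sqrt (n s)) has_real_derivative inverse (sqrt (n 0)) / 2 * (2 * (x \<bullet> v))) (at 0)"
    by (rule DERIV_chain2[rotated])
  then have dn: "((\<lambda>s. sqrt (n s)) has_real_derivative (x \<bullet> v) / norm x) (at 0)"
    by (rule DERIV_cong) (use nx in \<open>simp add: n0 sq field_simps\<close>)
  have g0: "sqrt (n 0) = norm x" by (simp add: n0 sq)
  have dx: "((\<lambda>s. x \<bullet> y + s * (v \<bullet> y)) has_real_derivative v \<bullet> y) (at 0)"
    by (auto intro!: derivative_eq_intros)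
  have "(p has_real_derivative ((v \<bullet> y) * norm x - (x \<bullet> y) * (x \<bullet> v) / norm x) / (norm x * norm x)) (at 0)"
    unfolding p_eq'
    by (rule DERIV_cong[OF DERIV_divide[OF dx dn]]) (use nx in \<open>simp_all add: g0\<close>)
  also have "(x \<bullet> y) * (x \<bullet> v) / norm x = t * (u \<bullet> v) * norm x"
  proof -
    have "x \<bullet> y = norm x * t" "x \<bullet> v = norm x * (u \<bullet> v)"
      by (subst x_eq, simp add: t_def)+
    then show ?thesis using nx by simp
  qed
  also have "((v \<bullet> y) * norm x - t * (u \<bullet> v) * norm x) / (norm x * norm x)
      = ((y - t *\<^sub>R u) \<bullet> v) / norm x"
    using nx by (simp add: inner_diff_left inner_commute[of y v] left_diff_distrib[symmetric])
  finally have dp: "(p has_real_derivative ((y - t *\<^sub>R u) \<bullet> v) / norm x) (at 0)" .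
  have p0: "p 0 = t" by (simp add: p_def t_def u_def)
  show ?thesis
  proof (cases "t = 1")
    case True
    then have y_eq: "y = u" using usphere_eqI[OF u y(1)] by (simp add: t_def)
    have lm: "log_map (sgn x) y = 0" using True by (simp add: log_map_def t_def u_def)
    have "((\<lambda>s. (p s - 1) / s) \<longlongrightarrow> 0) (at 0)"
      using dp True p0 by (simp add: y_eq has_field_derivative_iff)
    then have lim: "((\<lambda>s. 2 * \<bar>(p s - 1) / s\<bar>) \<longlongrightarrow> 0) (at 0)"
      using tendsto_mult[OF tendsto_const[of 2] tendsto_rabs] by fastforce
    have "isCont p 0" using dp by (rule DERIV_isCont)
    then have "eventually (\<lambda>s. 0 < p s) (at 0)"
      using p0 True by (auto simp: isCont_def intro: order_tendstoD)
    moreover have "eventually (\<lambda>s. s \<noteq> 0) (at (0::real))" by (simp add: eventually_at_filter)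
    ultimately have "eventually (\<lambda>s. norm (cost (sgn (x + s *\<^sub>R v)) y / s) \<le> 2 * \<bar>(p s - 1) / s\<bar>) (at 0)"
    proof eventually_elim
      case (elim s)
      have "p s \<le> 1"
      proof (cases "x + s *\<^sub>R v = 0")
        case False
        then show ?thesis using inner_usphere_abs_le[OF sgn_usphere y(1)] by (simp add: p_def abs_le_iff)
      qed (simp add: p_def)
      then have "\<bar>cost (sgn (x + s *\<^sub>R v)) y\<bar> \<le> 2 * \<bar>p s - 1\<bar>"
        using arccos_square_le[of "p s"] elim by (simp add: cost_def geodesic_dist_def p_def)
      then show ?case using elim by (simp add: divide_right_mono)
    qed
    from Lim_null_comparison[OF this lim]
    show ?thesis
      using True unfolding has_field_derivative_iff lm by (simp add: cost_def geodesic_dist_def t_def u_def)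
  next
    case False
    then have t: "-1 < t" "t < 1"
      using inner_usphere_abs_le[OF u y(1)] usphere_antipodeI[OF u y(1)] y(2)
      by (auto simp: abs_le_iff less_le t_def u_def)
    then have "sqrt (1 - t\<^sup>2) > 0" by (simp add: abs_square_less_1)
    have "((\<lambda>s. (arccos (p s))\<^sup>2 / 2) has_real_derivative
        arccos t * (inverse (- sqrt (1 - t\<^sup>2)) * (((y - t *\<^sub>R u) \<bullet> v) / norm x))) (at 0)"
      by (rule derivative_eq_intros DERIV_arccos[THEN DERIV_chain2] dp refl | use t p0 in simp)+
    also have "arccos t * (inverse (- sqrt (1 - t\<^sup>2)) * (((y - t *\<^sub>R u) \<bullet> v) / norm x))
      = - (log_map (sgn x) y \<bullet> v) / norm x"
      unfolding log_map_def t_def u_def inner_scaleR_left by (simp add: divide_inverse ac_simps)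
    finally show ?thesis by (simp add: cost_def geodesic_dist_def p_def)
  qed
qed

text \<open>
  The geodesic distance to the antipode of \<open>sgn x\<close> is maximal at \<open>x\<close> and decreases linearly to both
  sides on a line not parallel to \<open>x\<close>, so one antipodal partner suffices for a corner.
\<close>

lemma cost_antipode_peak:
  fixes x v :: "'a::euclidean_space"
  assumes x: "x \<noteq> 0" and v: "norm v = 1" and not_parallel: "v \<noteq> (sgn x \<bullet> v) *\<^sub>R sgn x"
  obtains b where "0 < b"
    "\<And>s. \<bar>s\<bar> \<le> 1 \<Longrightarrow> x + s *\<^sub>R v \<noteq> 0 \<Longrightarrow> cost (sgn (x + s *\<^sub>R v)) (- sgn x) - cost (sgn x) (- sgn x) \<le> - b * \<bar>s\<bar>"
proof -
  define u where "u = sgn x"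
  define \<nu> where "\<nu> = v - (u \<bullet> v) *\<^sub>R u"
  have u: "u \<in> usphere" using x by (simp add: u_def norm_sgn)
  then have uu: "u \<bullet> u = 1" by (rule inner_self_usphere)
  have x_eq: "x = norm x *\<^sub>R u" using x by (simp add: u_def sgn_div_norm)
  have \<nu>: "0 < norm \<nu>" using not_parallel by (simp add: \<nu>_def u_def)
  have u\<nu>: "u \<bullet> \<nu> = 0" using uu by (simp add: \<nu>_def inner_diff_right)
  then have v\<nu>: "v \<bullet> \<nu> = (norm \<nu>)\<^sup>2"
    unfolding power2_norm_eq_inner by (subst (2) \<nu>_def) (simp add: inner_diff_left)
  have x\<nu>: "x \<bullet> \<nu> = 0" by (subst x_eq) (simp add: u\<nu>)
  note orth = u\<nu> v\<nu> x\<nu>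
  define b where "b = pi / 2 * (norm \<nu> / (norm x + 1))"
  have "0 < b" unfolding b_def using \<nu> by (intro mult_pos_pos divide_pos_pos add_nonneg_pos) auto
  moreover have "cost (sgn (x + s *\<^sub>R v)) (- sgn x) - cost (sgn x) (- sgn x) \<le> - b * \<bar>s\<bar>"
    if s: "\<bar>s\<bar> \<le> 1" "x + s *\<^sub>R v \<noteq> 0" for s
  proof -
    define w where "w = sgn (x + s *\<^sub>R v)"
    define \<theta> where "\<theta> = arccos (w \<bullet> u)"
    have w: "w \<in> usphere" using s by (simp add: w_def norm_sgn)
    have wu: "-1 \<le> w \<bullet> u" "w \<bullet> u \<le> 1" using inner_usphere_abs_le[OF w u] by auto
    have \<theta>: "0 \<le> \<theta>" "\<theta> \<le> pi" using arccos_bounded[OF wu] by (auto simp: \<theta>_def)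
    have npos: "0 < norm (x + s *\<^sub>R v)" using s by simp
    have nle: "norm (x + s *\<^sub>R v) \<le> norm x + 1"
      using norm_triangle_ineq[of x "s *\<^sub>R v"] s(1) v by simp
    have "\<bar>s\<bar> * (norm \<nu>)\<^sup>2 / norm (x + s *\<^sub>R v) = \<bar>(w - u) \<bullet> \<nu>\<bar>"
      using npos by (simp add: w_def sgn_div_norm inner_simps orth divide_inverse abs_mult)
    also have "\<dots> \<le> norm (w - u) * norm \<nu>" by (rule Cauchy_Schwarz_ineq2)
    finally have "\<bar>s\<bar> * norm \<nu> / norm (x + s *\<^sub>R v) \<le> norm (w - u)"
      using mult_right_le_imp_le[OF _ \<nu>, of "\<bar>s\<bar> * norm \<nu> / norm (x + s *\<^sub>R v)"]
      by (simp add: power2_eq_square mult.assoc)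
    moreover have "\<bar>s\<bar> * norm \<nu> / (norm x + 1) \<le> \<bar>s\<bar> * norm \<nu> / norm (x + s *\<^sub>R v)"
      using nle npos by (intro divide_left_mono mult_pos_pos mult_nonneg_nonneg add_nonneg_pos) simp_all
    ultimately have "norm \<nu> / (norm x + 1) * \<bar>s\<bar> \<le> \<theta>"
      using chord_le_arccos[OF w u] by (simp add: \<theta>_def mult.commute)
    then have "b * \<bar>s\<bar> \<le> pi / 2 * \<theta>"
      unfolding b_def mult.assoc by (intro mult_left_mono) auto
    moreover have "cost w (- u) = (pi - \<theta>)\<^sup>2 / 2"
      using wu by (simp add: cost_def geodesic_dist_def \<theta>_def arccos_minus)
    moreover have "cost u (- u) = pi\<^sup>2 / 2"
      using uu by (simp add: cost_def geodesic_dist_def)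
    moreover have "(pi - \<theta>)\<^sup>2 / 2 - pi\<^sup>2 / 2 \<le> - (pi / 2 * \<theta>)"
    proof -
      have "\<theta> * \<theta> \<le> \<theta> * pi" using \<theta> by (intro mult_left_mono) auto
      then show ?thesis by (simp add: power2_eq_square field_simps)
    qed
    ultimately show ?thesis by (simp add: w_def u_def)
  qed
  ultimately show ?thesis using that by blast
qed

lemma DERIV_linear_upper_bound:
  fixes f :: "real \<Rightarrow> real"
  assumes "(f has_real_derivative a) (at 0)" "0 < e"
  shows "\<exists>d>0. \<forall>s. \<bar>s\<bar> < d \<longrightarrow> f s - f 0 \<le> a * s + e * \<bar>s\<bar>"
proof -
  obtain d where d: "0 < d" "\<And>s. s \<noteq> 0 \<Longrightarrow> \<bar>s\<bar> < d \<Longrightarrow> \<bar>(f s - f 0) / s - a\<bar> < e"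
    using LIM_D[OF assms(1)[unfolded DERIV_def] assms(2)] by auto
  have "f s - f 0 \<le> a * s + e * \<bar>s\<bar>" if s: "\<bar>s\<bar> < d" for s
  proof (cases "s = 0")
    case False
    have "f s - f 0 - a * s = ((f s - f 0) / s - a) * s"
      using False by (simp add: field_simps)
    then have "\<bar>f s - f 0 - a * s\<bar> = \<bar>(f s - f 0) / s - a\<bar> * \<bar>s\<bar>"
      by (simp only: abs_mult)
    also have "\<dots> \<le> e * \<bar>s\<bar>" using d(2)[OF False s] by (intro mult_right_mono) auto
    finally show ?thesis by linarith
  qed simp
  with d(1) show ?thesis by blast
qed

text \<open>
  If \<open>sgn x\<close> has two optimal partners, \<open>\<phi>\<close> lies below two cost functions that touch it there. If
  both are smooth, their gradients differ because a partner is determined by its gradient, so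
  along some axis \<open>\<phi>\<close> has a corner. If one partner is the antipode, its cost function alone
  produces a corner along every axis not parallel to \<open>x\<close>; this is where the dimension is used.
\<close>

lemma ambiguous_in_corners:
  fixes x y y' :: "'a::euclidean_space"
  assumes dim: "2 \<le> DIM('a)"
    and le: "\<And>x y. x \<in> usphere \<Longrightarrow> y \<in> usphere \<Longrightarrow> \<phi> x + \<psi> y \<le> cost x y"
    and x: "x \<noteq> 0" and y: "y \<in> usphere" and y': "y' \<in> usphere" and neq: "y \<noteq> y'"
    and eq: "\<phi> (sgn x) + \<psi> y = cost (sgn x) y" "\<phi> (sgn x) + \<psi> y' = cost (sgn x) y'"
  shows "\<exists>v\<in>Basis. \<exists>r\<in>\<rat>. \<exists>m::nat. x \<in> corners (\<lambda>x. \<phi> (sgn x)) v r (1 / Suc m)"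
proof -
  define u where "u = sgn x"
  have u: "u \<in> usphere" unfolding u_def by (rule sgn_usphere[OF x])
  have nx: "0 < norm x" using x by simp
  have touch: "\<phi> (sgn (x + s *\<^sub>R v)) - \<phi> (sgn x) \<le> cost (sgn (x + s *\<^sub>R v)) z - cost (sgn x) z"
    if z: "z \<in> usphere" "\<phi> (sgn x) + \<psi> z = cost (sgn x) z" and "x + s *\<^sub>R v \<noteq> 0" for z s v
    using le[OF sgn_usphere[OF that(3)] z(1)] z(2) by linarith
  have nz: "x + s *\<^sub>R v \<noteq> 0" if "v \<in> Basis" "\<bar>s\<bar> < norm x" for s v
    using norm_triangle_ineq2[of x "- s *\<^sub>R v"] that by auto
  show ?thesis
  proof (cases "y = - u \<or> y' = - u")
    case True
    then have au: "- u \<in> usphere" "\<phi> (sgn x) + \<psi> (- u) = cost (sgn x) (- u)"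
      using eq y y' by auto
    obtain v where v: "v \<in> Basis" "v \<noteq> (u \<bullet> v) *\<^sub>R u"
    proof -
      obtain v1 v2 :: 'a where b: "v1 \<in> Basis" "v2 \<in> Basis" "v1 \<noteq> v2"
        using dim by (metis card_2_iff' card_le_Suc0_iff_eq finite_Basis not_less_eq_eq numeral_2_eq_2)
      have False if p: "v1 = (u \<bullet> v1) *\<^sub>R u" "v2 = (u \<bullet> v2) *\<^sub>R u"
      proof -
        have "v1 \<bullet> v2 = (u \<bullet> v1) * (u \<bullet> v2)"
          by (subst p(1)) simp
        then have "u \<bullet> v1 = 0 \<or> u \<bullet> v2 = 0" using b by (simp add: inner_Basis)
        then have "v1 = 0 \<or> v2 = 0" using p by auto
        then show False using b nonzero_Basis by blast
      qed
      then show ?thesis using b that by blast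
    qed
    have nv: "norm v = 1" using v(1) by simp
    obtain b where b: "0 < b" "\<And>s. \<bar>s\<bar> \<le> 1 \<Longrightarrow> x + s *\<^sub>R v \<noteq> 0 \<Longrightarrow>
        cost (sgn (x + s *\<^sub>R v)) (- sgn x) - cost (sgn x) (- sgn x) \<le> - b * \<bar>s\<bar>"
      by (rule cost_antipode_peak[OF x nv v(2)[unfolded u_def]]) (rule that)
    define d where "d = min 1 (norm x)"
    have d: "0 < d" using nx by (simp add: d_def)
    have peak: "\<phi> (sgn (x + s *\<^sub>R v)) - \<phi> (sgn x) \<le> - b * \<bar>s\<bar>" if "\<bar>s\<bar> < d" for s
      using touch[OF au nz[OF v(1), of s]] b(2)[of s] nz[OF v(1), of s] that
      by (simp add: d_def u_def)
    have "\<exists>r\<in>\<rat>. \<exists>m::nat. x \<in> corners (\<lambda>x. \<phi> (sgn x)) v r (1 / Suc m)"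
    proof (rule mem_corners[OF x])
      show "- b < b" using b(1) by simp
      fix e :: real assume e: "0 < e"
      show "\<exists>d>0. \<forall>s. 0 < s \<and> s < d \<longrightarrow> \<phi> (sgn (x + s *\<^sub>R v)) - \<phi> (sgn x) \<le> (- b + e) * s"
      proof (intro exI[of _ d] conjI allI impI)
        fix s assume s: "0 < s \<and> s < d"
        have "- b * \<bar>s\<bar> \<le> (- b + e) * s" using s mult_nonneg_nonneg[of e s] e by (simp add: algebra_simps)
        then show "\<phi> (sgn (x + s *\<^sub>R v)) - \<phi> (sgn x) \<le> (- b + e) * s" using peak[of s] s by auto
      qed (rule d)
      show "\<exists>d>0. \<forall>s. - d < s \<and> s < 0 \<longrightarrow> \<phi> (sgn (x + s *\<^sub>R v)) - \<phi> (sgn x) \<le> (b - e) * s"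
      proof (intro exI[of _ d] conjI allI impI)
        fix s assume s: "- d < s \<and> s < 0"
        have "- b * \<bar>s\<bar> \<le> (b - e) * s" using s mult_nonneg_nonpos[of e s] e by (simp add: algebra_simps)
        moreover have "\<bar>s\<bar> < d" using s by linarith
        ultimately show "\<phi> (sgn (x + s *\<^sub>R v)) - \<phi> (sgn x) \<le> (b - e) * s"
          using peak[of s] by linarith
      qed (rule d)
    qed
    then show ?thesis using v(1) by blast
  next
    case False
    have "log_map u y \<noteq> log_map u y'"
      using log_map_inj[OF u y _ y'] False neq by blast
    then obtain v where v: "v \<in> Basis" "log_map u y \<bullet> v \<noteq> log_map u y' \<bullet> v"
      by (metis euclidean_eqI)
    define slope where "slope z = - (log_map u z \<bullet> v) / norm x" for z
    have tangent: "\<exists>d>0. \<forall>s. \<bar>s\<bar> < d \<longrightarrow> \<phi> (sgn (x + s *\<^sub>R v)) - \<phi> (sgn x) \<le> slope z * s + e * \<bar>s\<bar>"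
      if z: "z \<in> usphere" "\<phi> (sgn x) + \<psi> z = cost (sgn x) z" "z \<noteq> - u" and e: "0 < e" for z e
    proof -
      obtain d where d: "0 < d" "\<And>s. \<bar>s\<bar> < d \<Longrightarrow>
          cost (sgn (x + s *\<^sub>R v)) z - cost (sgn (x + 0 *\<^sub>R v)) z \<le> slope z * s + e * \<bar>s\<bar>"
        using DERIV_linear_upper_bound[OF cost_line_derivative[OF x z(1), of v] e] z(3)
        unfolding slope_def u_def by blast
      show ?thesis
      proof (intro exI[of _ "min d (norm x)"] conjI allI impI)
        fix s assume s: "\<bar>s\<bar> < min d (norm x)"
        have "cost (sgn (x + s *\<^sub>R v)) z - cost (sgn x) z \<le> slope z * s + e * \<bar>s\<bar>"
          using d(2)[of s] s by simp
        moreover have "x + s *\<^sub>R v \<noteq> 0" using nz[OF v(1), of s] s by simp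
        ultimately show "\<phi> (sgn (x + s *\<^sub>R v)) - \<phi> (sgn x) \<le> slope z * s + e * \<bar>s\<bar>"
          using touch[OF z(1,2)] by (meson order_trans)
      qed (use d(1) nx in simp)
    qed
    have corner: "\<exists>r\<in>\<rat>. \<exists>m::nat. x \<in> corners (\<lambda>x. \<phi> (sgn x)) v r (1 / Suc m)"
      if z: "z \<in> usphere" "\<phi> (sgn x) + \<psi> z = cost (sgn x) z" "z \<noteq> - u"
        and z': "z' \<in> usphere" "\<phi> (sgn x) + \<psi> z' = cost (sgn x) z'" "z' \<noteq> - u"
        and lt: "slope z < slope z'" for z z'
    proof (rule mem_corners[OF x lt])
      fix e :: real assume e: "0 < e"
      obtain d where d: "0 < d" "\<And>s. \<bar>s\<bar> < d \<Longrightarrow> \<phi> (sgn (x + s *\<^sub>R v)) - \<phi> (sgn x) \<le> slope z * s + e * \<bar>s\<bar>"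
        using tangent[OF z e] by blast
      show "\<exists>d>0. \<forall>s. 0 < s \<and> s < d \<longrightarrow> \<phi> (sgn (x + s *\<^sub>R v)) - \<phi> (sgn x) \<le> (slope z + e) * s"
      proof (intro exI[of _ d] conjI allI impI)
        fix s assume s: "0 < s \<and> s < d"
        then show "\<phi> (sgn (x + s *\<^sub>R v)) - \<phi> (sgn x) \<le> (slope z + e) * s"
          using d(2)[of s] by (simp add: distrib_right)
      qed (rule d(1))
      obtain d where d: "0 < d" "\<And>s. \<bar>s\<bar> < d \<Longrightarrow> \<phi> (sgn (x + s *\<^sub>R v)) - \<phi> (sgn x) \<le> slope z' * s + e * \<bar>s\<bar>"
        using tangent[OF z' e] by blast
      show "\<exists>d>0. \<forall>s. - d < s \<and> s < 0 \<longrightarrow> \<phi> (sgn (x + s *\<^sub>R v)) - \<phi> (sgn x) \<le> (slope z' - e) * s"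
      proof (intro exI[of _ d] conjI allI impI)
        fix s assume s: "- d < s \<and> s < 0"
        then show "\<phi> (sgn (x + s *\<^sub>R v)) - \<phi> (sgn x) \<le> (slope z' - e) * s"
          using d(2)[of s] by (simp add: left_diff_distrib)
      qed (rule d(1))
    qed
    have "slope y \<noteq> slope y'" using v(2) nx by (simp add: slope_def)
    then have "slope y < slope y' \<or> slope y' < slope y" by linarith
    then show ?thesis
      using corner[OF y eq(1) _ y' eq(2)] corner[OF y' eq(2) _ y eq(1)] False v(1) by blast
  qed
qed

text \<open>
  The surface measure of a set is proportional to the volume of its cone, and the cone over the
  ambiguous points is covered by countably many corner sets. The ambiguous points themselves form
  a countable union of compact sets, on which the two partners keep a distance \<open>1 / m\<close>.
\<close>

lemma ambiguous_points_null:
  fixes \<phi> \<psi> :: "'a::euclidean_space \<Rightarrow> real"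
  assumes dim: "2 \<le> DIM('a)"
    and \<phi>: "continuous_on usphere \<phi>" and \<psi>: "continuous_on usphere \<psi>"
    and le: "\<And>x y. x \<in> usphere \<Longrightarrow> y \<in> usphere \<Longrightarrow> \<phi> x + \<psi> y \<le> cost x y"
  shows "{x\<in>usphere. \<exists>y\<in>usphere. \<exists>y'\<in>usphere. y \<noteq> y' \<and>
      \<phi> x + \<psi> y = cost x y \<and> \<phi> x + \<psi> y' = cost x y'} \<in> null_sets surface_measure" (is "?N \<in> _")
proof -
  define C where "C m = {p \<in> usphere \<times> usphere \<times> usphere. 1 / real (Suc m) \<le> norm (fst (snd p) - snd (snd p)) \<and>
      \<phi> (fst p) + \<psi> (fst (snd p)) = cost (fst p) (fst (snd p)) \<and>
      \<phi> (fst p) + \<psi> (snd (snd p)) = cost (fst p) (snd (snd p))}" for m :: nat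
  have eqN: "?N = (\<Union>m. fst ` C m)"
  proof (intro set_eqI iffI)
    fix x assume "x \<in> ?N"
    then obtain y y' where y: "x \<in> usphere" "y \<in> usphere" "y' \<in> usphere" "y \<noteq> y'"
      "\<phi> x + \<psi> y = cost x y" "\<phi> x + \<psi> y' = cost x y'" by blast
    obtain m where "1 / real (Suc m) < norm (y - y')"
      using nat_approx_posE[of "norm (y - y')"] y(4) by auto
    then have "(x, y, y') \<in> C m" using y by (simp add: C_def)
    then show "x \<in> (\<Union>m. fst ` C m)" by force
  next
    fix x assume "x \<in> (\<Union>m. fst ` C m)"
    then obtain m y y' where p: "(x, y, y') \<in> C m" by auto
    then have "0 < norm (y - y')" by (auto simp: C_def elim!: order_less_le_trans[rotated])
    then have "y \<noteq> y'" by auto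
    moreover have "x \<in> usphere" "y \<in> usphere" "y' \<in> usphere"
      "\<phi> x + \<psi> y = cost x y" "\<phi> x + \<psi> y' = cost x y'" using p by (auto simp: C_def)
    ultimately show "x \<in> ?N" by blast
  qed
  have "closed (C m)" for m
  proof -
    let ?S = "usphere \<times> usphere \<times> usphere :: ('a \<times> 'a \<times> 'a) set"
    have cl: "closed ?S" by (intro closed_Times closed_sphere)
    have closed_eq: "closed {p \<in> ?S. f p = h p}"
      if "continuous_on ?S f" "continuous_on ?S h" for f h :: "'a \<times> 'a \<times> 'a \<Rightarrow> real"
    proof -
      have "{p \<in> ?S. f p = h p} = {p \<in> ?S. f p \<le> h p} \<inter> {p \<in> ?S. h p \<le> f p}" by auto
      then show ?thesis
        using that cl by (simp only:) (intro closed_Int continuous_on_closed_Collect_le)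
    qed
    have c: "continuous_on ?S (\<lambda>p. \<phi> (fst p))" "continuous_on ?S (\<lambda>p. \<psi> (fst (snd p)))"
      "continuous_on ?S (\<lambda>p. \<psi> (snd (snd p)))"
      by (rule continuous_on_compose2[OF \<phi>] continuous_on_compose2[OF \<psi>]; auto intro!: continuous_intros)+
    have "continuous_on ?S (\<lambda>p. (\<lambda>q. cost (fst q) (snd q)) (fst p, fst (snd p)))"
      by (rule continuous_on_compose2[OF continuous2_cost]) (auto intro!: continuous_intros)
    then have c1: "continuous_on ?S (\<lambda>p. cost (fst p) (fst (snd p)))" by simp
    have "continuous_on ?S (\<lambda>p. (\<lambda>q. cost (fst q) (snd q)) (fst p, snd (snd p)))"
      by (rule continuous_on_compose2[OF continuous2_cost]) (auto intro!: continuous_intros)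
    then have c2: "continuous_on ?S (\<lambda>p. cost (fst p) (snd (snd p)))" by simp
    have "C m = {p \<in> ?S. 1 / real (Suc m) \<le> norm (fst (snd p) - snd (snd p))} \<inter>
        {p \<in> ?S. \<phi> (fst p) + \<psi> (fst (snd p)) = cost (fst p) (fst (snd p))} \<inter>
        {p \<in> ?S. \<phi> (fst p) + \<psi> (snd (snd p)) = cost (fst p) (snd (snd p))}"
      by (auto simp: C_def)
    then show ?thesis
      by (simp only:) (intro closed_Int continuous_on_closed_Collect_le closed_eq
          continuous_intros c c1 c2 cl)
  qed
  moreover have "C m \<subseteq> usphere \<times> usphere \<times> usphere" for m by (auto simp: C_def)
  moreover have "compact (usphere \<times> usphere \<times> usphere :: ('a \<times> 'a \<times> 'a) set)"
    by (intro compact_Times compact_sphere)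
  ultimately have "compact (C m)" for m
    using compact_Int_closed by (metis inf.absorb_iff2)
  then have "compact (fst ` C m)" for m
    by (intro compact_continuous_image continuous_intros)
  then have "fst ` C m \<in> sets borel" for m by (intro borel_closed compact_imp_closed)
  then have "?N \<in> sets borel" unfolding eqN by blast
  moreover have subN: "?N \<subseteq> usphere" by blast
  ultimately have N: "?N \<in> sets sphere_borel" by (simp add: sets_restrict_space_iff)
  define B where "B = (\<Union>v\<in>Basis. \<Union>r\<in>\<rat>. \<Union>m::nat. corners (\<lambda>x. \<phi> (sgn x)) v r (1 / Suc m))"
  have cont: "continuous_on (- {0}) (\<lambda>x. \<phi> (sgn x))"
    by (rule continuous_on_compose2[OF \<phi>]) (auto intro!: continuous_intros simp: norm_sgn split: if_splits)
  have B: "B \<in> null_sets lborel"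
    unfolding B_def
    by (intro null_sets_UN' corners_null cont countable_rat countableI_type countable_finite) auto
  have sub: "{t *\<^sub>R x | t x. 0 < t \<and> t \<le> 1 \<and> x \<in> ?N} \<subseteq> B"
  proof
    fix z assume "z \<in> {t *\<^sub>R x | t x. 0 < t \<and> t \<le> 1 \<and> x \<in> ?N}"
    then obtain t x where z: "z = t *\<^sub>R x" "0 < t" and x: "x \<in> ?N" by blast
    then have sz: "sgn z = x" "z \<noteq> 0" by (auto simp: sgn_div_norm)
    from x obtain y y' where y: "y \<in> usphere" "y' \<in> usphere" "y \<noteq> y'"
      "\<phi> x + \<psi> y = cost x y" "\<phi> x + \<psi> y' = cost x y'" by blast
    show "z \<in> B"
      using ambiguous_in_corners[OF dim le sz(2) y(1-3)] y(4,5) unfolding sz(1) B_def by blast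
  qed
  have "emeasure lborel {t *\<^sub>R x | t x. 0 < t \<and> t \<le> 1 \<and> x \<in> ?N} \<le> emeasure lborel B"
    using sub B by (intro emeasure_mono) auto
  also have "\<dots> = 0" using B by auto
  finally show ?thesis
    using emeasure_surface_measure[OF N] N by (intro null_setsI) auto
qed

section \<open>Dual potentials of a finite assignment problem\<close>

fun walk_weight :: "('i \<Rightarrow> 'i \<Rightarrow> real) \<Rightarrow> 'i list \<Rightarrow> real" where
  "walk_weight w (x # y # zs) = w x y + walk_weight w (y # zs)"
| "walk_weight w _ = 0"

lemma walk_weight_append:
  "walk_weight w (xs @ x # ys) = walk_weight w (xs @ [x]) + walk_weight w (x # ys)"
proof (induction xs)
  case (Cons a xs)
  then show ?case by (cases xs) auto
qed simp

lemma walk_weight_zip: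
  "walk_weight w (x # xs @ [z]) = sum_list (map2 w (x # xs) (xs @ [z]))"
  by (induction xs arbitrary: x) auto

text \<open>
  A simple closed walk is a cyclic permutation, and any other closed walk splits at a repeated
  vertex into two shorter closed walks. Hence optimality against permutations already excludes
  negative closed walks of every length.
\<close>

lemma closed_walk_nonneg:
  assumes I: "finite I"
    and opt: "\<And>T. T permutes I \<Longrightarrow> 0 \<le> (\<Sum>i\<in>I. w i (T i))"
    and diag: "\<And>i. w i i = 0"
  shows "set (x # xs) \<subseteq> I \<Longrightarrow> 0 \<le> walk_weight w (x # xs @ [x])"
proof (induction "length xs" arbitrary: x xs rule: less_induct)
  case less
  show ?case
  proof (cases "distinct (x # xs)")
    case True
    define T where "T = cycle_of_list (x # xs)"
    have T: "T permutes set (x # xs)"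
      unfolding T_def by (rule cycle_permutes)
    have rot: "map T (x # xs) = xs @ [x]"
      using cyclic_rotation[of "x # xs" 1] True by (simp add: T_def)
    have "0 \<le> (\<Sum>i\<in>I. w i (T i))"
      using opt permutes_subset[OF T less.prems] by blast
    also have "\<dots> = (\<Sum>i\<in>set (x # xs). w i (T i))"
      using less.prems I by (intro sum.mono_neutral_right) (auto simp: permutes_not_in[OF T] diag)
    also have "\<dots> = sum_list (map (\<lambda>i. w i (T i)) (x # xs))"
      using True by (metis sum_list_distinct_conv_sum_set)
    also have "\<dots> = sum_list (map2 w (x # xs) (map T (x # xs)))"
      by (simp add: zip_map2 zip_same_conv_map o_def)
    also have "\<dots> = walk_weight w (x # xs @ [x])"
      unfolding rot walk_weight_zip ..
    finally show ?thesis .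
  next
    case False
    then obtain as y bs cs where eq: "x # xs = as @ y # bs @ y # cs"
      using not_distinct_decomp[OF False] by auto
    have sub: "set (y # bs) \<subseteq> I" "set (y # cs) \<subseteq> I"
      using less.prems unfolding eq by auto
    show ?thesis
    proof (cases as)
      case Nil
      then have x: "x = y" "xs = bs @ y # cs" using eq by auto
      have "0 \<le> walk_weight w (y # bs @ [y])" "0 \<le> walk_weight w (y # cs @ [y])"
        using x sub by (auto intro!: less.hyps)
      then show ?thesis
        using walk_weight_append[of w "y # bs" y "cs @ [y]"] by (simp add: x)
    next
      case (Cons a as')
      then have x: "x = a" "xs = as' @ y # bs @ y # cs" using eq by auto
      have "0 \<le> walk_weight w (x # (as' @ y # cs) @ [x])"
        using less.prems by (intro less.hyps) (auto simp: x)
      moreover have "0 \<le> walk_weight w (y # bs @ [y])"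
        using sub by (intro less.hyps) (auto simp: x)
      ultimately show ?thesis
        using walk_weight_append[of w "x # as'" y "bs @ y # cs @ [x]"]
          walk_weight_append[of w "y # bs" y "cs @ [x]"]
          walk_weight_append[of w "x # as'" y "cs @ [x]"]
        by (simp add: x)
    qed
  qed
qed

text \<open>
  Shortest-path distances from a fixed vertex, finite because there are no negative closed
  walks, are potentials for the assignment that matches every index with itself.
\<close>

lemma assignment_potentials:
  fixes c :: "'i \<Rightarrow> 'i \<Rightarrow> real"
  assumes I: "finite I"
    and opt: "\<And>T. T permutes I \<Longrightarrow> (\<Sum>i\<in>I. c i i) \<le> (\<Sum>i\<in>I. c i (T i))"
  obtains v where "\<And>i j. i \<in> I \<Longrightarrow> j \<in> I \<Longrightarrow> c i i - v i \<le> c i j - v j"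
proof (cases "I = {}")
  case True
  then show ?thesis using that by blast
next
  case False
  then obtain a where a: "a \<in> I" by blast
  define w where "w i j = c i j - c i i" for i j
  define W where "W j = (\<lambda>xs. walk_weight w (a # xs @ [j])) ` {xs. set xs \<subseteq> I}" for j
  define v where "v j = Inf (W j)" for j
  have closed: "0 \<le> walk_weight w (x # xs @ [x])" if "set (x # xs) \<subseteq> I" for x xs
    by (rule closed_walk_nonneg[OF I _ _ that]) (use opt in \<open>auto simp: w_def sum_subtractf\<close>)
  have bdd: "bdd_below (W j)" if "j \<in> I" for j
  proof (rule bdd_belowI)
    fix z assume "z \<in> W j"
    then obtain xs where "set xs \<subseteq> I" "z = walk_weight w (a # xs @ [j])" by (auto simp: W_def)
    then show "- w j a \<le> z"
      using closed[of a "xs @ [j]"] walk_weight_append[of w "a # xs" j "[a]"] a that by simp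
  qed
  have ne: "W j \<noteq> {}" for j by (auto simp: W_def intro: exI[of _ "[]"])
  have "v j \<le> v i + w i j" if "i \<in> I" "j \<in> I" for i j
  proof -
    have "v j - w i j \<le> z" if "z \<in> W i" for z
    proof -
      obtain xs where xs: "set xs \<subseteq> I" "z = walk_weight w (a # xs @ [i])"
        using \<open>z \<in> W i\<close> by (auto simp: W_def)
      have "walk_weight w (a # (xs @ [i]) @ [j]) \<in> W j"
        unfolding W_def by (rule imageI) (use xs \<open>i \<in> I\<close> in auto)
      then have "v j \<le> walk_weight w (a # (xs @ [i]) @ [j])"
        unfolding v_def using bdd[OF \<open>j \<in> I\<close>] by (rule cInf_lower)
      then show ?thesis
        using walk_weight_append[of w "a # xs" i "[j]"] xs by simp
    qed
    then have "v j - w i j \<le> v i"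
      unfolding v_def[of i] by (rule cInf_greatest[OF ne])
    then show ?thesis by simp
  qed
  then show ?thesis
    by (intro that[of v]) (fastforce simp: w_def)
qed

section \<open>Probability measures on the sphere\<close>

locale sphere_prob = prob_space \<mu> for \<mu> :: "'a::euclidean_space measure" +
  assumes sets_\<mu> [simp, measurable_cong]: "sets \<mu> = sets sphere_borel"
begin

lemma space_\<mu> [simp]: "space \<mu> = usphere"
  using sets_eq_imp_space_eq[OF sets_\<mu>] by (simp add: space_restrict_space)

lemma prob_usphere [simp]: "prob usphere = 1"
  using prob_space by simp

lemma continuous_measurable: "continuous_on usphere f \<Longrightarrow> f \<in> borel_measurable \<mu>"
  using borel_measurable_continuous_on_restrict[of usphere f] by simp

lemma continuous_integrable:
  fixes f :: "'a \<Rightarrow> real"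
  assumes f: "continuous_on usphere f"
  shows "integrable \<mu> f"
proof -
  obtain B where "\<And>x. x \<in> usphere \<Longrightarrow> \<bar>f x\<bar> \<le> B"
    by (rule continuous2_bounded[OF continuous2_one_variable(1)[OF f]]) blast
  then show ?thesis
    by (intro integrable_const_bound[of _ B] AE_I2 continuous_measurable[OF f]) simp
qed

lemma integral_mono_continuous:
  fixes f g :: "'a \<Rightarrow> real"
  assumes "continuous_on usphere f" "continuous_on usphere g" "\<And>x. x \<in> usphere \<Longrightarrow> f x \<le> g x"
  shows "(\<integral>x. f x \<partial>\<mu>) \<le> (\<integral>x. g x \<partial>\<mu>)"
  by (rule integral_mono) (use assms in \<open>simp_all add: continuous_integrable\<close>)

lemma integral_le_const:
  fixes f :: "'a \<Rightarrow> real"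
  assumes "continuous_on usphere f" "\<And>x. x \<in> usphere \<Longrightarrow> f x \<le> c"
  shows "(\<integral>x. f x \<partial>\<mu>) \<le> c"
  using integral_mono_continuous[OF assms(1) continuous_on_const assms(2)] by (simp add: prob_space)

end

text \<open>
  The continuous functions \<open>max 0 (1 - k dist(x, X))\<close> decrease to the indicator of a closed set \<open>X\<close>,
  and the closed sets generate the Borel sets.
\<close>

lemma sphere_prob_eqI:
  fixes \<mu> \<nu> :: "'a::euclidean_space measure"
  assumes "sphere_prob \<mu>" "sphere_prob \<nu>"
    and eq: "\<And>f :: 'a \<Rightarrow> real. continuous_on usphere f \<Longrightarrow> (\<integral>x. f x \<partial>\<mu>) = (\<integral>x. f x \<partial>\<nu>)"
  shows "\<mu> = \<nu>"
proof -
  interpret M: sphere_prob \<mu> by fact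
  interpret N: sphere_prob \<nu> by fact
  define E where "E = (\<lambda>A. A \<inter> usphere) ` {A :: 'a set. closed A}"
  have sets_E: "sets (sphere_borel :: 'a measure) = sigma_sets usphere E"
  proof -
    have "sets (sphere_borel :: 'a measure) = (\<lambda>A. usphere \<inter> A) ` sigma_sets UNIV (Collect closed)"
      by (simp add: sets_restrict_space borel_eq_closed)
    also have "\<dots> = sigma_sets usphere E"
      by (subst sigma_sets_Int[of usphere UNIV]) (auto simp: E_def Int_commute)
    finally show ?thesis .
  qed
  show ?thesis
  proof (rule measure_eqI_generator_eq[of E usphere _ _ "\<lambda>_. usphere"])
    show "Int_stable E"
    proof (rule Int_stableI)
      fix X Y assume "X \<in> E" "Y \<in> E"
      then obtain A B where "closed A" "closed B" "X = A \<inter> usphere" "Y = B \<inter> usphere"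
        by (auto simp: E_def)
      then show "X \<inter> Y \<in> E"
        unfolding E_def by (intro image_eqI[of _ _ "A \<inter> B"]) auto
    qed
    show "E \<subseteq> Pow usphere" "range (\<lambda>_. usphere) \<subseteq> E" by (auto simp: E_def intro!: image_eqI[of _ _ UNIV])
    show "sets \<mu> = sigma_sets usphere E" "sets \<nu> = sigma_sets usphere E"
      using sets_E by simp_all
    fix X assume "X \<in> E"
    then obtain A where A: "closed A" "X = A \<inter> usphere" by (auto simp: E_def)
    show "emeasure \<mu> X = emeasure \<nu> X"
    proof (cases "X = {}")
      case False
      then have Xc: "closed X" using A by auto
      define f where "f k x = max 0 (1 - real k * infdist x X)" for k :: nat and x
      have cont: "continuous_on usphere (f k)" for k
        unfolding f_def by (intro continuous_intros)
      have lim: "(\<lambda>k. f k x) \<longlonglongrightarrow> indicator X x" for x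
      proof (cases "x \<in> X")
        case True
        then show ?thesis by (simp add: f_def)
      next
        case False
        then have pos: "0 < infdist x X"
          using in_closed_iff_infdist_zero[OF Xc \<open>X \<noteq> {}\<close>] infdist_nonneg[of x X] by force
        obtain K :: nat where K: "1 / infdist x X < K" using reals_Archimedean2 by blast
        have "f k x = 0" if "K \<le> k" for k
        proof -
          have "1 / infdist x X \<le> real k" using K that by linarith
          then show ?thesis using pos by (simp add: f_def pos_divide_le_eq)
        qed
        then have "eventually (\<lambda>k. f k x = indicator X x) sequentially"
          using False by (auto simp: eventually_sequentially)
        then show ?thesis by (rule tendsto_eventually)
      qed
      have bound: "norm (f k x) \<le> 1" for k x
        by (simp add: f_def infdist_nonneg)
      have meas: "X \<in> sets sphere_borel" using A by (auto simp: sets_restrict_space_iff)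
      have conv: "(\<lambda>k. \<integral>x. f k x \<partial>\<tau>) \<longlonglongrightarrow> measure \<tau> X" if "sphere_prob \<tau>" for \<tau>
      proof -
        interpret T: sphere_prob \<tau> by fact
        have "(\<lambda>k. \<integral>x. f k x \<partial>\<tau>) \<longlonglongrightarrow> (\<integral>x. indicator X x \<partial>\<tau>)"
          by (rule integral_dominated_convergence[where w = "\<lambda>_. 1"])
             (use meas lim bound in \<open>auto intro!: T.continuous_measurable[OF cont]\<close>)
        moreover have "X \<inter> usphere = X" using A by auto
        ultimately show ?thesis using meas by simp
      qed
      have "measure \<mu> X = measure \<nu> X"
        using LIMSEQ_unique[OF conv[OF assms(1)]] conv[OF assms(2)] eq[OF cont] by simp
      then show ?thesis by (simp add: M.emeasure_eq_measure N.emeasure_eq_measure)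
    qed simp
  qed (use M.emeasure_eq_measure in auto)
qed

text \<open>The cone over a relatively open set contains an open subset of the ball.\<close>

lemma surface_measure_open_pos:
  fixes W :: "'a::euclidean_space set"
  assumes W: "open W" "W \<inter> usphere \<noteq> {}"
  shows "0 < emeasure surface_measure (W \<inter> usphere)"
proof -
  define G where "G = {z. z \<noteq> 0 \<and> norm z < 1 \<and> sgn z \<in> W}"
  have "open ((- {0} \<inter> sgn -` W) \<inter> ball 0 1)"
    by (intro open_Int open_ball continuous_open_preimage W(1)) (auto intro!: continuous_intros)
  also have "(- {0} \<inter> sgn -` W) \<inter> ball 0 1 = G" by (auto simp: G_def)
  finally have "open G" .
  moreover from W(2) obtain x where "x \<in> W" "norm x = 1" by auto
  then have "(1/2) *\<^sub>R x \<in> G" by (auto simp: G_def sgn_div_norm)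
  ultimately have "\<not> negligible G" by (intro open_not_negligible) auto
  then have "G \<notin> null_sets lborel"
    using null_sets_completionI[of G lborel] by (auto simp: negligible_iff_null_sets)
  then have G: "0 < emeasure lborel G"
    using \<open>open G\<close> by (auto simp: null_sets_def zero_less_iff_neq_zero)
  define C where "C = {t *\<^sub>R x | t x. 0 < t \<and> t \<le> 1 \<and> x \<in> W \<inter> usphere}"
  have "C = (cball 0 1 - {0}) \<inter> sgn -` W"
  proof (intro set_eqI iffI)
    fix z assume "z \<in> (cball 0 1 - {0}) \<inter> sgn -` W"
    then have "z = norm z *\<^sub>R sgn z" "0 < norm z" "norm z \<le> 1" "sgn z \<in> W \<inter> usphere"
      by (auto simp: sgn_div_norm norm_sgn)
    then show "z \<in> C" unfolding C_def by blast
  qed (auto simp: C_def sgn_div_norm)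
  also have "\<dots> \<in> sets borel"
    using W(1) measurable_sets[of sgn borel borel W] by (intro sets.Int) auto
  finally have "C \<in> sets lborel" by simp
  moreover have "G \<subseteq> C"
  proof
    fix z assume "z \<in> G"
    then have "z = norm z *\<^sub>R sgn z" "0 < norm z" "norm z \<le> 1" "sgn z \<in> W \<inter> usphere"
      by (auto simp: G_def sgn_div_norm norm_sgn)
    then show "z \<in> C" unfolding C_def by blast
  qed
  ultimately have "0 < emeasure lborel C"
    using G emeasure_mono[of G C lborel] by (auto intro: order_less_le_trans)
  moreover have "W \<inter> usphere \<in> sets sphere_borel"
    using W(1) by (auto simp: sets_restrict_space)
  ultimately show ?thesis
    by (simp add: emeasure_surface_measure C_def ennreal_zero_less_mult_iff)
qed

lemma sphere_prob_uniform: "sphere_prob (uniform_sphere :: 'a::euclidean_space measure)"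
proof -
  have pos: "0 < emeasure surface_measure (usphere :: 'a set)"
    using surface_measure_open_pos[of UNIV] usphere_not_empty by simp
  have "usphere \<in> sets (sphere_borel :: 'a measure)"
    using sets.top[of sphere_borel] by (simp add: space_restrict_space)
  then have "emeasure surface_measure (usphere :: 'a set)
      = ennreal (real DIM('a)) * emeasure lborel {t *\<^sub>R x | t (x::'a). 0 < t \<and> t \<le> 1 \<and> x \<in> usphere}"
    by (rule emeasure_surface_measure)
  also have "\<dots> \<le> ennreal (real DIM('a)) * emeasure lborel (cball (0::'a) 1)"
    by (intro mult_left_mono emeasure_mono) auto
  also have "\<dots> < \<infinity>"
    using emeasure_lborel_cball_finite[of "0::'a" 1] by (simp add: ennreal_mult_less_top)
  finally have "prob_space (uniform_sphere :: 'a measure)"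
    unfolding uniform_sphere_def using pos by (intro prob_space_uniform_measure) auto
  then show ?thesis
    by (simp add: sphere_prob_def sphere_prob_axioms_def uniform_sphere_def)
qed

lemma sphere_prob_directional_family:
  assumes "P \<in> directional_family"
  shows "sphere_prob P"
  using assms by (auto simp: directional_family_def sphere_prob_def sphere_prob_axioms_def)

lemma directional_family_AE:
  assumes P: "P \<in> directional_family" and N: "N \<in> null_sets surface_measure"
  shows "AE x in P. x \<notin> N"
proof -
  obtain f where f: "f \<in> borel_measurable surface_measure" "P = density surface_measure (\<lambda>x. ennreal (f x))"
    using P by (auto simp: directional_family_def)
  have "AE x in density surface_measure (\<lambda>x. ennreal (f x)). x \<notin> N"
    using AE_not_in[OF N] f(1) by (subst AE_density) auto
  then show ?thesis unfolding f(2) .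
qed

lemma directional_family_open_pos:
  assumes P: "P \<in> directional_family" and W: "open W" "W \<inter> usphere \<noteq> {}"
  shows "0 < emeasure P (W \<inter> usphere)"
proof -
  obtain f a b where f: "f \<in> borel_measurable surface_measure"
    "P = density surface_measure (\<lambda>x. ennreal (f x))" "0 < a" "\<forall>x\<in>usphere. a \<le> f x \<and> f x \<le> b"
    using P by (auto simp: directional_family_def)
  have S: "W \<inter> usphere \<in> sets surface_measure"
    using W(1) by (auto simp: sets_restrict_space)
  have "0 < ennreal a * emeasure surface_measure (W \<inter> usphere)"
    using surface_measure_open_pos[OF W] f(3) by (simp add: ennreal_zero_less_mult_iff)
  also have "\<dots> = (\<integral>\<^sup>+x. ennreal a * indicator (W \<inter> usphere) x \<partial>surface_measure)"
    using S by (simp add: nn_integral_cmult)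
  also have "\<dots> \<le> (\<integral>\<^sup>+x. ennreal (f x) * indicator (W \<inter> usphere) x \<partial>surface_measure)"
    by (intro nn_integral_mono mult_right_mono ennreal_leI) (use f(4) in auto)
  also have "\<dots> = emeasure P (W \<inter> usphere)"
    unfolding f(2) using S f(1) by (subst emeasure_density) auto
  finally show ?thesis .
qed

section \<open>The dual problem\<close>

locale sphere_prob_pair = P: sphere_prob P + Q: sphere_prob Q for P Q :: "'a::euclidean_space measure"
begin

definition dual_value :: "('a \<Rightarrow> real) \<Rightarrow> real" where
  "dual_value \<psi> = (\<integral>y. \<psi> y \<partial>Q) + (\<integral>x. conjugate \<psi> x \<partial>P)"

lemma dual_value_le:
  assumes \<psi>: "continuous_on usphere \<psi>"
  shows "dual_value \<psi> \<le> pi\<^sup>2 / 2"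
proof -
  obtain y where y: "y \<in> usphere" "\<And>y'. y' \<in> usphere \<Longrightarrow> \<psi> y' \<le> \<psi> y"
    using continuous_attains_sup[OF compact_sphere usphere_not_empty \<psi>] by blast
  have "(\<integral>y. \<psi> y \<partial>Q) \<le> \<psi> y" using \<psi> y(2) by (rule Q.integral_le_const)
  moreover have "(\<integral>x. conjugate \<psi> x \<partial>P) \<le> pi\<^sup>2 / 2 - \<psi> y"
  proof (rule P.integral_le_const[OF continuous_conjugate[OF \<psi>]])
    fix x :: 'a assume "x \<in> usphere"
    then show "conjugate \<psi> x \<le> pi\<^sup>2 / 2 - \<psi> y"
      using conjugate_le[OF \<psi> _ y(1)] cost_bounds(2)[OF _ y(1)] by (smt (verit))
  qed
  ultimately show ?thesis by (simp add: dual_value_def)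
qed

lemma dual_value_close:
  assumes \<psi>: "continuous_on usphere \<psi>" and \<psi>': "continuous_on usphere \<psi>'"
    and close: "\<And>y. y \<in> usphere \<Longrightarrow> \<bar>\<psi> y - \<psi>' y\<bar> \<le> e"
  shows "dual_value \<psi> \<le> dual_value \<psi>' + 2 * e"
proof -
  have "(\<integral>y. \<psi> y \<partial>Q) \<le> (\<integral>y. \<psi>' y + e \<partial>Q)"
    by (intro Q.integral_mono_continuous continuous_intros \<psi> \<psi>') (use close in force)
  moreover have "(\<integral>x. conjugate \<psi> x \<partial>P) \<le> (\<integral>x. conjugate \<psi>' x + e \<partial>P)"
  proof (intro P.integral_mono_continuous continuous_intros continuous_conjugate \<psi> \<psi>')
    fix x :: 'a assume "x \<in> usphere"
    then show "conjugate \<psi> x \<le> conjugate \<psi>' x + e"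
      by (rule conjugate_le_conjugate[OF \<psi>' \<psi>]) (use close in \<open>simp add: abs_le_iff algebra_simps\<close>)
  qed
  ultimately show ?thesis
    using Q.continuous_integrable[OF \<psi>'] P.continuous_integrable[OF continuous_conjugate[OF \<psi>']]
    by (simp add: dual_value_def P.prob_space Q.prob_space)
qed

lemma dual_value_shift:
  assumes \<psi>: "continuous_on usphere \<psi>"
  shows "dual_value (\<lambda>y. \<psi> y - a) = dual_value \<psi>"
proof -
  have c: "continuous_on usphere (\<lambda>y. \<psi> y - a)" by (intro continuous_intros \<psi>)
  have "conjugate (\<lambda>y. \<psi> y - a) x = conjugate \<psi> x + a" if x: "x \<in> usphere" for x
    using conjugate_le_conjugate[OF c \<psi> x, of "-a"] conjugate_le_conjugate[OF \<psi> c x, of a] by simp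
  then have "(\<integral>x. conjugate (\<lambda>y. \<psi> y - a) x \<partial>P) = (\<integral>x. conjugate \<psi> x + a \<partial>P)"
    by (intro Bochner_Integration.integral_cong) auto
  then show ?thesis
    using Q.continuous_integrable[OF \<psi>] P.continuous_integrable[OF continuous_conjugate[OF \<psi>]]
    by (simp add: dual_value_def P.prob_space Q.prob_space)
qed

lemma dual_value_conjugate_conjugate:
  assumes \<psi>: "continuous_on usphere \<psi>"
  shows "dual_value \<psi> \<le> dual_value (conjugate (conjugate \<psi>))"
proof -
  note c = continuous_conjugate[OF \<psi>] and cc = continuous_conjugate[OF continuous_conjugate[OF \<psi>]]
  have "(\<integral>y. \<psi> y \<partial>Q) \<le> (\<integral>y. conjugate (conjugate \<psi>) y \<partial>Q)"
    by (intro Q.integral_mono_continuous \<psi> cc conjugate_conjugate_ge)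
  moreover have "(\<integral>x. conjugate \<psi> x \<partial>P) \<le> (\<integral>x. conjugate (conjugate (conjugate \<psi>)) x \<partial>P)"
    by (intro P.integral_mono_continuous c continuous_conjugate cc conjugate_conjugate_ge)
  ultimately show ?thesis by (simp add: dual_value_def)
qed

text \<open>
  Double conjugation does not decrease the dual value and moves a maximising sequence into the
  compact family of potentials with the modulus of continuity of the cost.
\<close>

lemma dual_maximiser:
  obtains \<psi> where "continuous_on usphere \<psi>"
    "\<And>\<psi>'. continuous_on usphere \<psi>' \<Longrightarrow> dual_value \<psi>' \<le> dual_value \<psi>"
proof -
  define A where "A = dual_value ` {\<psi>. continuous_on usphere \<psi>}"
  define V where "V = Sup A"
  have bdd: "bdd_above A"
    unfolding A_def by (rule bdd_aboveI[of _ "pi\<^sup>2 / 2"]) (use dual_value_le in blast)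
  have ne: "A \<noteq> {}" by (auto simp: A_def intro: continuous_on_const)
  obtain x0 :: 'a where x0: "x0 \<in> usphere" using usphere_not_empty by blast
  have "\<exists>\<psi>. cost_modulus \<psi> \<and> \<psi> x0 = 0 \<and> V - 1 / real (Suc n) < dual_value \<psi>" for n
  proof -
    obtain a where "a \<in> A" "V - 1 / real (Suc n) < a"
      using less_cSup_iff[OF ne bdd, of "V - 1 / real (Suc n)"] by (auto simp: V_def)
    then obtain \<psi> where \<psi>: "continuous_on usphere \<psi>" "V - 1 / real (Suc n) < dual_value \<psi>"
      by (auto simp: A_def)
    define \<psi>' where "\<psi>' = conjugate (conjugate \<psi>)"
    define \<psi>'' where "\<psi>'' y = \<psi>' y - \<psi>' x0" for y
    have mod: "cost_modulus \<psi>'"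
      unfolding \<psi>'_def by (intro cost_modulus_conjugate continuous_conjugate \<psi>(1))
    then have "cost_modulus \<psi>''" by (simp add: cost_modulus_def \<psi>''_def)
    moreover have "dual_value \<psi> \<le> dual_value \<psi>''"
      using dual_value_conjugate_conjugate[OF \<psi>(1)]
        dual_value_shift[OF cost_modulus_continuous[OF mod], of "\<psi>' x0"]
      unfolding \<psi>''_def[abs_def] \<psi>'_def[symmetric] by simp
    ultimately show ?thesis
      using \<psi>(2) by (intro exI[of _ \<psi>'']) (auto simp: \<psi>''_def)
  qed
  then obtain \<Psi> where \<Psi>: "\<And>n. cost_modulus (\<Psi> n)" "\<And>n. \<Psi> n x0 = 0"
    "\<And>n. V - 1 / real (Suc n) < dual_value (\<Psi> n)"
    by metis
  obtain g r where g: "continuous_on usphere g" and r: "strict_mono (r :: nat \<Rightarrow> nat)"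
    and lim: "\<And>e. 0 < e \<Longrightarrow> \<exists>N. \<forall>n x. n \<ge> N \<and> x \<in> usphere \<longrightarrow> \<bar>\<Psi> (r n) x - g x\<bar> < e"
    by (rule cost_modulus_subsequence[of \<Psi> x0, OF \<Psi>(1) x0 \<Psi>(2)]) (rule that)
  have "V \<le> dual_value g + e" if "0 < e" for e
  proof -
    have e3: "0 < e / 3" using that by simp
    obtain N where N: "\<And>n x. n \<ge> N \<Longrightarrow> x \<in> usphere \<Longrightarrow> \<bar>\<Psi> (r n) x - g x\<bar> < e / 3"
      using lim[OF e3] by auto
    obtain M where M: "1 / real (Suc M) < e / 3" using nat_approx_posE[OF e3] by blast
    define n where "n = max N M"
    have "M \<le> r n" using seq_suble[OF r, of n] by (simp add: n_def)
    then have "1 / real (Suc (r n)) \<le> 1 / real (Suc M)" by (intro divide_left_mono) auto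
    moreover have "dual_value (\<Psi> (r n)) \<le> dual_value g + 2 * (e / 3)"
      by (rule dual_value_close[OF cost_modulus_continuous[OF \<Psi>(1)] g])
         (use N[of n] in \<open>auto simp: n_def intro: less_imp_le\<close>)
    ultimately show ?thesis using \<Psi>(3)[of "r n"] M by linarith
  qed
  then have "V \<le> dual_value g" by (rule field_le_epsilon)
  moreover have "dual_value \<psi>' \<le> V" if "continuous_on usphere \<psi>'" for \<psi>'
    unfolding V_def using that bdd by (intro cSup_upper) (auto simp: A_def)
  ultimately show ?thesis using g that by (meson order_trans)
qed

end

definition slack :: "('a::euclidean_space \<Rightarrow> real) \<Rightarrow> 'a \<Rightarrow> 'a \<Rightarrow> real" where
  "slack \<psi> x y = cost x y - conjugate \<psi> x - \<psi> y"

lemma continuous2_slack: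
  assumes "continuous_on usphere \<psi>"
  shows "continuous2 (slack \<psi>)"
  unfolding slack_def
  by (intro continuous_intros continuous2_cost continuous2_one_variable continuous_conjugate assms)

lemma slack_nonneg:
  assumes "continuous_on usphere \<psi>" "x \<in> usphere" "y \<in> usphere"
  shows "0 \<le> slack \<psi> x y"
  using conjugate_le[OF assms] by (simp add: slack_def)

lemma slack_zero_exists:
  assumes "continuous_on usphere \<psi>" "x \<in> usphere"
  obtains y where "y \<in> usphere" "slack \<psi> x y = 0"
proof -
  obtain y where "y \<in> usphere" "conjugate \<psi> x + \<psi> y = cost x y"
    by (rule conjugate_attained[OF assms]) (rule that)
  then show ?thesis using that[of y] by (simp add: slack_def)
qed

text \<open>
  First-order optimality of the maximiser: adding \<open>f / k\<close> to \<open>\<psi>\<close> lowers its conjugate by at most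
  \<open>1 / k\<close> times the penalised maximum of \<open>f\<close>.
\<close>

lemma (in sphere_prob_pair) dual_maximiser_variation:
  assumes \<psi>: "continuous_on usphere \<psi>"
    and max: "\<And>\<psi>'. continuous_on usphere \<psi>' \<Longrightarrow> dual_value \<psi>' \<le> dual_value \<psi>"
    and f: "continuous_on usphere f" and k: "0 < k"
  shows "(\<integral>y. f y \<partial>Q) \<le> (\<integral>x. fibre_max (\<lambda>x y. f y - k * slack \<psi> x y) x \<partial>P)"
proof -
  define h where "h = fibre_max (\<lambda>x y. f y - k * slack \<psi> x y)"
  have arg: "continuous2 (\<lambda>x y. f y - k * slack \<psi> x y)"
    by (intro continuous_intros continuous2_one_variable continuous2_slack \<psi> f)
  have h: "continuous_on usphere h" unfolding h_def by (rule continuous_fibre_max[OF arg])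
  define \<psi>' where "\<psi>' y = \<psi> y + f y / k" for y
  have \<psi>': "continuous_on usphere \<psi>'" unfolding \<psi>'_def using k by (intro continuous_intros \<psi> f) auto
  note c = continuous_conjugate[OF \<psi>]
  have "conjugate \<psi> x - h x / k \<le> conjugate \<psi>' x" if x: "x \<in> usphere" for x
  proof (rule conjugate_greatest[OF \<psi>' x])
    fix y :: 'a assume y: "y \<in> usphere"
    have "f y - k * slack \<psi> x y \<le> h x" unfolding h_def by (rule fibre_max_upper[OF arg x y])
    then have "(f y - k * slack \<psi> x y) / k \<le> h x / k" using k by (intro divide_right_mono) auto
    then have "f y / k \<le> h x / k + slack \<psi> x y" using k by (simp add: diff_divide_distrib)
    then show "conjugate \<psi> x - h x / k + \<psi>' y \<le> cost x y" by (simp add: \<psi>'_def slack_def)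
  qed
  then have "(\<integral>x. conjugate \<psi> x - h x / k \<partial>P) \<le> (\<integral>x. conjugate \<psi>' x \<partial>P)"
    using k by (intro P.integral_mono_continuous continuous_intros c h continuous_conjugate \<psi>') auto
  moreover have "(\<integral>x. conjugate \<psi> x - h x / k \<partial>P) = (\<integral>x. conjugate \<psi> x \<partial>P) - (\<integral>x. h x \<partial>P) / k"
    using P.continuous_integrable[OF c] P.continuous_integrable[OF h] by simp
  moreover have "(\<integral>y. \<psi>' y \<partial>Q) = (\<integral>y. \<psi> y \<partial>Q) + (\<integral>y. f y \<partial>Q) / k"
    unfolding \<psi>'_def using Q.continuous_integrable[OF \<psi>] Q.continuous_integrable[OF f] by simp
  ultimately have "(\<integral>y. f y \<partial>Q) / k \<le> (\<integral>x. h x \<partial>P) / k"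
    using max[OF \<psi>'] by (simp add: dual_value_def)
  then show ?thesis using k by (simp add: h_def divide_le_cancel)
qed

text \<open>
  Dominated convergence applies because every \<open>x\<close> has a partner of slack \<open>0\<close>, so the penalised
  maxima stay within the bounds of \<open>f\<close> for all \<open>k\<close>.
\<close>

lemma (in sphere_prob) integral_fibre_max_penalised:
  assumes f: "continuous2 f" and \<psi>: "continuous_on usphere \<psi>" and S: "\<And>x. x \<in> usphere \<Longrightarrow> S x \<in> usphere"
    and meas: "(\<lambda>x. f x (S x)) \<in> borel_measurable \<mu>"
    and zero: "AE x in \<mu>. slack \<psi> x (S x) = 0 \<and> (\<forall>y\<in>usphere. slack \<psi> x y = 0 \<longrightarrow> y = S x)"
  shows "(\<lambda>k. \<integral>x. fibre_max (\<lambda>x y. f x y - real k * slack \<psi> x y) x \<partial>\<mu>) \<longlonglongrightarrow> (\<integral>x. f x (S x) \<partial>\<mu>)"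
proof -
  obtain B where B: "\<And>x y. x \<in> usphere \<Longrightarrow> y \<in> usphere \<Longrightarrow> \<bar>f x y\<bar> \<le> B"
    by (rule continuous2_bounded[OF f]) (rule that)
  have c: "continuous2 (\<lambda>x y. f x y - real k * slack \<psi> x y)" for k
    by (intro continuous_intros f continuous2_slack \<psi>)
  show ?thesis
  proof (rule integral_dominated_convergence[where w = "\<lambda>_. B"])
    show "AE x in \<mu>. (\<lambda>k. fibre_max (\<lambda>x y. f x y - real k * slack \<psi> x y) x) \<longlonglongrightarrow> f x (S x)"
      using zero
    proof (rule AE_mp, intro AE_I2 impI)
      fix x assume "x \<in> space \<mu>" and z: "slack \<psi> x (S x) = 0 \<and> (\<forall>y\<in>usphere. slack \<psi> x y = 0 \<longrightarrow> y = S x)"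
      then have x: "x \<in> usphere" by simp
      show "(\<lambda>k. fibre_max (\<lambda>x y. f x y - real k * slack \<psi> x y) x) \<longlonglongrightarrow> f x (S x)"
        by (rule fibre_max_penalised_limit[OF f continuous2_slack[OF \<psi>] slack_nonneg[OF \<psi> x] x S[OF x]])
           (use z in auto)
    qed
    fix k
    show "AE x in \<mu>. norm (fibre_max (\<lambda>x y. f x y - real k * slack \<psi> x y) x) \<le> B"
    proof (rule AE_I2)
      fix x assume "x \<in> space \<mu>"
      then have x: "x \<in> usphere" by simp
      obtain y where y: "y \<in> usphere" "slack \<psi> x y = 0" by (rule slack_zero_exists[OF \<psi> x]) (rule that)
      have "- B \<le> fibre_max (\<lambda>x y. f x y - real k * slack \<psi> x y) x"
        using fibre_max_upper[OF c x y(1), of k] y(2) B[OF x y(1)] by simp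
      moreover have "fibre_max (\<lambda>x y. f x y - real k * slack \<psi> x y) x \<le> B"
      proof (rule fibre_max_least[OF c x])
        fix y :: 'a assume y: "y \<in> usphere"
        have "0 \<le> real k * slack \<psi> x y" using slack_nonneg[OF \<psi> x y] by simp
        then show "f x y - real k * slack \<psi> x y \<le> B" using B[OF x y] by linarith
      qed
      ultimately show "norm (fibre_max (\<lambda>x y. f x y - real k * slack \<psi> x y) x) \<le> B" by simp
    qed
    show "fibre_max (\<lambda>x y. f x y - real k * slack \<psi> x y) \<in> borel_measurable \<mu>"
      by (rule continuous_measurable[OF continuous_fibre_max[OF c]])
  qed (use meas in auto)
qed

section \<open>The continuous optimal map is the only optimal coupling\<close>

lemma continuous2_measurable_graph:
  fixes f :: "'a::euclidean_space \<Rightarrow> 'a \<Rightarrow> real"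
  assumes f: "continuous2 f" and S: "S \<in> sphere_borel \<rightarrow>\<^sub>M sphere_borel"
  shows "(\<lambda>x. f x (S x)) \<in> borel_measurable sphere_borel"
proof -
  have range: "S \<in> usphere \<rightarrow> usphere"
    using measurable_space[OF S] by (auto simp: space_restrict_space)
  have Sb: "S \<in> borel_measurable sphere_borel"
    using S by (simp add: measurable_restrict_space2_iff)
  have "(\<lambda>x. (x, S x)) \<in> sphere_borel \<rightarrow>\<^sub>M restrict_space borel (usphere \<times> usphere)"
  proof (rule measurable_restrict_space2)
    show "(\<lambda>x. (x, S x)) \<in> borel_measurable sphere_borel"
      by (intro borel_measurable_Pair Sb measurable_restrict_space1) simp
  qed (use range in \<open>auto simp: space_restrict_space\<close>)
  from measurable_compose[OF this borel_measurable_continuous_on_restrict[OF f]] show ?thesis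
    by simp
qed

text \<open>
  Almost every point has a unique partner of slack \<open>0\<close>, which defines a map \<open>S\<close>. By first-order
  optimality of the potential, \<open>S\<close> transports \<open>P\<close> to the uniform distribution, and its cost is the
  dual value. A continuous optimal map \<open>F\<close> costs no more, so its mean slack is at most \<open>0\<close>; as the
  slack is nonnegative, the graph of \<open>F\<close> lies in the zero set too and \<open>F = S\<close> almost everywhere.
\<close>

lemma directional_df_potential:
  fixes P :: "'a::euclidean_space measure"
  assumes dim: "2 \<le> DIM('a)" and P: "P \<in> directional_family" and F: "directional_df P F"
  obtains \<psi> where "continuous_on usphere \<psi>"
    "\<And>\<psi>'. continuous_on usphere \<psi>' \<Longrightarrow>
      sphere_prob_pair.dual_value P uniform_sphere \<psi>' \<le> sphere_prob_pair.dual_value P uniform_sphere \<psi>"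
    "AE x in P. slack \<psi> x (F x) = 0 \<and> (\<forall>y\<in>usphere. slack \<psi> x y = 0 \<longrightarrow> y = F x)"
proof -
  interpret D: sphere_prob_pair P uniform_sphere
    unfolding sphere_prob_pair_def
    using sphere_prob_directional_family[OF P] sphere_prob_uniform by blast
  obtain \<psi> where \<psi>: "continuous_on usphere \<psi>"
    and max: "\<And>\<psi>'. continuous_on usphere \<psi>' \<Longrightarrow> D.dual_value \<psi>' \<le> D.dual_value \<psi>"
    by (rule D.dual_maximiser) (rule that)
  note c\<psi> = continuous_conjugate[OF \<psi>]
  define N where "N = {x\<in>usphere. \<exists>y\<in>usphere. \<exists>y'\<in>usphere. y \<noteq> y' \<and>
      conjugate \<psi> x + \<psi> y = cost x y \<and> conjugate \<psi> x + \<psi> y' = cost x y'}"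
  have N: "N \<in> null_sets surface_measure"
    unfolding N_def by (rule ambiguous_points_null[OF dim c\<psi> \<psi> conjugate_le[OF \<psi>]])
  then have N_sets: "N \<in> sets sphere_borel" by auto
  have AE_N: "AE x in P. x \<notin> N" by (rule directional_family_AE[OF P N])
  obtain e0 :: 'a where e0: "e0 \<in> usphere" using usphere_not_empty by blast
  define S where "S x = (if x \<in> usphere - N then SOME y. y \<in> usphere \<and> slack \<psi> x y = 0 else e0)" for x
  have S: "S x \<in> usphere" "slack \<psi> x (S x) = 0" if x: "x \<in> usphere" "x \<notin> N" for x
  proof -
    obtain y where "y \<in> usphere" "slack \<psi> x y = 0"
      by (rule slack_zero_exists[OF \<psi> x(1)]) (rule that)
    then have "\<exists>y. y \<in> usphere \<and> slack \<psi> x y = 0" by blast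
    from someI_ex[OF this] show "S x \<in> usphere" "slack \<psi> x (S x) = 0"
      using x by (auto simp: S_def)
  qed
  have S_range: "S x \<in> usphere" for x
    using S(1)[of x] e0 by (cases "x \<in> usphere - N") (auto simp: S_def)
  have S_unique: "y = S x" if "x \<in> usphere" "x \<notin> N" "y \<in> usphere" "slack \<psi> x y = 0" for x y
  proof (rule ccontr)
    assume "y \<noteq> S x"
    moreover have "conjugate \<psi> x + \<psi> y = cost x y" "conjugate \<psi> x + \<psi> (S x) = cost x (S x)"
      using that(4) S(2)[OF that(1,2)] by (simp_all add: slack_def)
    ultimately have "x \<in> N"
      using that(1,3) S(1)[OF that(1,2)] unfolding N_def by blast
    with that(2) show False by contradiction
  qed
  have S_zero: "AE x in P. slack \<psi> x (S x) = 0 \<and> (\<forall>y\<in>usphere. slack \<psi> x y = 0 \<longrightarrow> y = S x)"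
    using AE_N
  proof (rule AE_mp, intro AE_I2 impI)
    fix x assume "x \<in> space P" "x \<notin> N"
    then show "slack \<psi> x (S x) = 0 \<and> (\<forall>y\<in>usphere. slack \<psi> x y = 0 \<longrightarrow> y = S x)"
      using S(2)[of x] S_unique[of x] by simp
  qed
  \<comment> \<open>The coordinates of \<open>S\<close> are limits of penalised maxima, which are continuous.\<close>
  have S_coord: "(\<lambda>x. S x \<bullet> v) \<in> borel_measurable sphere_borel" for v
  proof (rule borel_measurable_LIMSEQ_real)
    have fc: "continuous2 (\<lambda>x y. y \<bullet> v)" by (intro continuous_intros)
    define u where "u k x = (if x \<in> N then e0 \<bullet> v
      else fibre_max (\<lambda>x y. y \<bullet> v - real k * slack \<psi> x y) x)" for k :: nat and x
    show "u k \<in> borel_measurable sphere_borel" for k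
      unfolding u_def
    proof (rule measurable_If_set)
      show "fibre_max (\<lambda>x y. y \<bullet> v - real k * slack \<psi> x y) \<in> borel_measurable sphere_borel"
        by (intro borel_measurable_continuous_on_restrict continuous_fibre_max continuous_intros
            continuous2_slack[OF \<psi>])
      have "N \<inter> usphere = N" by (auto simp: N_def)
      then show "N \<inter> space sphere_borel \<in> sets sphere_borel"
        using N_sets by (simp add: space_restrict_space)
    qed simp
    fix x :: 'a assume "x \<in> space sphere_borel"
    then have x: "x \<in> usphere" by (simp add: space_restrict_space)
    show "(\<lambda>k. u k x) \<longlonglongrightarrow> S x \<bullet> v"
    proof (cases "x \<in> N")
      case True
      then show ?thesis by (simp add: u_def S_def)
    next
      case False
      have "(\<lambda>k. fibre_max (\<lambda>x y. y \<bullet> v - real k * slack \<psi> x y) x) \<longlonglongrightarrow> S x \<bullet> v"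
        by (rule fibre_max_penalised_limit[OF fc continuous2_slack[OF \<psi>] slack_nonneg[OF \<psi> x] x
              S[OF x False] S_unique[OF x False]])
      then show ?thesis using False by (simp add: u_def)
    qed
  qed
  have S_meas: "S \<in> sphere_borel \<rightarrow>\<^sub>M sphere_borel"
    by (rule measurable_restrict_space2)
       (use S_range in blast, rule borel_measurable_euclidean_space[THEN iffD2, rule_format, OF S_coord])
  then have S_meas_P: "S \<in> P \<rightarrow>\<^sub>M sphere_borel" by (simp cong: measurable_cong_sets)
  have fS: "(\<lambda>x. f (S x)) \<in> borel_measurable P" if "continuous_on usphere f" for f :: "'a \<Rightarrow> real"
    using measurable_compose[OF S_meas_P borel_measurable_continuous_on_restrict[OF that]] .
  have le: "(\<integral>y. f y \<partial>uniform_sphere) \<le> (\<integral>x. f (S x) \<partial>P)" if f: "continuous_on usphere f" for f :: "'a \<Rightarrow> real"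
  proof (rule LIMSEQ_le_const)
    show "(\<lambda>k. \<integral>x. fibre_max (\<lambda>x y. f y - real k * slack \<psi> x y) x \<partial>P) \<longlonglongrightarrow> (\<integral>x. f (S x) \<partial>P)"
      by (rule D.P.integral_fibre_max_penalised[OF continuous2_one_variable(2)[OF f] \<psi> S_range fS[OF f] S_zero])
    show "\<exists>K. \<forall>k\<ge>K. (\<integral>y. f y \<partial>uniform_sphere) \<le> (\<integral>x. fibre_max (\<lambda>x y. f y - real k * slack \<psi> x y) x \<partial>P)"
      using D.dual_maximiser_variation[OF \<psi> max f] by (intro exI[of _ 1]) auto
  qed
  have push: "(\<integral>y. f y \<partial>uniform_sphere) = (\<integral>x. f (S x) \<partial>P)" if f: "continuous_on usphere f" for f :: "'a \<Rightarrow> real"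
  proof (rule antisym)
    have "continuous_on usphere (\<lambda>y. - f y)" by (intro continuous_intros f)
    from le[OF this] show "(\<integral>x. f (S x) \<partial>P) \<le> (\<integral>y. f y \<partial>uniform_sphere)" by simp
  qed (rule le[OF f])
  have "distr P sphere_borel S = uniform_sphere"
  proof (rule sphere_prob_eqI)
    show "sphere_prob (distr P sphere_borel S)"
      using D.P.prob_space_distr[OF S_meas_P] by (simp add: sphere_prob_def sphere_prob_axioms_def)
    show "sphere_prob (uniform_sphere :: 'a measure)" by (rule sphere_prob_uniform)
    fix f :: "'a \<Rightarrow> real" assume f: "continuous_on usphere f"
    show "(\<integral>x. f x \<partial>distr P sphere_borel S) = (\<integral>x. f x \<partial>uniform_sphere)"
      using push[OF f] by (simp add: integral_distr[OF S_meas_P borel_measurable_continuous_on_restrict[OF f]])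
  qed
  with S_meas have "transports P S" by (simp add: transports_def)
  then have cost_le: "transport_cost P F \<le> transport_cost P S"
    using F by (simp add: directional_df_def)
  have \<psi>S_int: "integrable P (\<lambda>x. \<psi> (S x))"
  proof -
    obtain B where B: "\<And>x. x \<in> usphere \<Longrightarrow> \<bar>\<psi> x\<bar> \<le> B"
      by (rule continuous2_bounded[OF continuous2_one_variable(1)[OF \<psi>]]) blast
    show ?thesis
      by (rule D.P.integrable_const_bound[of _ B]) (use B S_range fS[OF \<psi>] in auto)
  qed
  have "transport_cost P S = (\<integral>x. conjugate \<psi> x + \<psi> (S x) \<partial>P)"
    unfolding transport_cost_def
  proof (rule integral_cong_AE)
    show "AE x in P. cost x (S x) = conjugate \<psi> x + \<psi> (S x)"
      using S_zero by eventually_elim (simp add: slack_def)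
    show "(\<lambda>x. cost x (S x)) \<in> borel_measurable P"
      using continuous2_measurable_graph[OF continuous2_cost S_meas] by (simp cong: measurable_cong_sets)
    show "(\<lambda>x. conjugate \<psi> x + \<psi> (S x)) \<in> borel_measurable P"
      by (intro borel_measurable_add D.P.continuous_measurable c\<psi> fS \<psi>)
  qed
  also have "\<dots> = D.dual_value \<psi>"
    using push[OF \<psi>] D.P.continuous_integrable[OF c\<psi>] \<psi>S_int by (simp add: D.dual_value_def)
  finally have cost_S: "transport_cost P S = D.dual_value \<psi>" .
  have Fm: "F \<in> sphere_borel \<rightarrow>\<^sub>M sphere_borel" and Fd: "distr P sphere_borel F = uniform_sphere"
    and Fc: "continuous_on usphere F"
    using F by (auto simp: directional_df_def transports_def)
  have Fr: "F ` usphere \<subseteq> usphere"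
    using measurable_space[OF Fm] by (auto simp: space_restrict_space)
  have Fm_P: "F \<in> P \<rightarrow>\<^sub>M sphere_borel" using Fm by (simp cong: measurable_cong_sets)
  have c\<psi>F: "continuous_on usphere (\<lambda>x. \<psi> (F x))"
    by (rule continuous_on_compose2[OF \<psi> Fc Fr])
  have c_cost: "continuous_on usphere (\<lambda>x. cost x (F x))"
    by (rule continuous2_graph[OF continuous2_cost Fc Fr])
  have c_slack: "continuous_on usphere (\<lambda>x. slack \<psi> x (F x))"
    by (rule continuous2_graph[OF continuous2_slack[OF \<psi>] Fc Fr])
  have "(\<integral>x. \<psi> (F x) \<partial>P) = (\<integral>y. \<psi> y \<partial>uniform_sphere)"
    by (subst Fd[symmetric], subst integral_distr[OF Fm_P borel_measurable_continuous_on_restrict[OF \<psi>]]) simp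
  then have "(\<integral>x. slack \<psi> x (F x) \<partial>P) = transport_cost P F - D.dual_value \<psi>"
    using D.P.continuous_integrable[OF c\<psi>F] D.P.continuous_integrable[OF c_cost]
      D.P.continuous_integrable[OF c\<psi>]
    by (simp add: slack_def transport_cost_def D.dual_value_def)
  then have int_le: "(\<integral>x. slack \<psi> x (F x) \<partial>P) \<le> 0" using cost_le cost_S by simp
  have nonneg: "AE x in P. 0 \<le> slack \<psi> x (F x)"
  proof (rule AE_I2)
    fix x assume "x \<in> space P"
    then have x: "x \<in> usphere" by simp
    then have "F x \<in> usphere" using Fr by blast
    with x show "0 \<le> slack \<psi> x (F x)" by (rule slack_nonneg[OF \<psi>])
  qed
  have "(\<integral>x. slack \<psi> x (F x) \<partial>P) = 0"
    using int_le integral_nonneg_AE[OF nonneg] by simp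
  then have "AE x in P. slack \<psi> x (F x) = 0"
    using integral_nonneg_eq_0_iff_AE[OF D.P.continuous_integrable[OF c_slack] nonneg] by simp
  then have "AE x in P. slack \<psi> x (F x) = 0 \<and> (\<forall>y\<in>usphere. slack \<psi> x y = 0 \<longrightarrow> y = F x)"
    using S_zero AE_space[of P]
  proof eventually_elim
    case (elim x)
    have "x \<in> usphere" using elim(3) by simp
    then have "F x \<in> usphere" using Fr by blast
    then have "F x = S x" using elim by blast
    then show ?case using elim by simp
  qed
  then show ?thesis using \<psi> max that by blast
qed

section \<open>Stability of optimal matchings\<close>

definition avg :: "nat \<Rightarrow> (nat \<Rightarrow> real) \<Rightarrow> real" where
  "avg n a = (\<Sum>i=1..n. a i) / real n"

lemma avg_mono: "(\<And>i. i \<in> {1..n} \<Longrightarrow> a i \<le> b i) \<Longrightarrow> avg n a \<le> avg n b"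
  unfolding avg_def by (intro divide_right_mono sum_mono) auto

lemma avg_add: "avg n (\<lambda>i. a i + b i) = avg n a + avg n b"
  and avg_diff: "avg n (\<lambda>i. a i - b i) = avg n a - avg n b"
  and avg_cmult: "avg n (\<lambda>i. k * a i) = k * avg n a"
  by (simp_all add: avg_def sum.distrib sum_subtractf add_divide_distrib diff_divide_distrib sum_distrib_left)

lemma avg_const: "n \<noteq> 0 \<Longrightarrow> avg n (\<lambda>i. k) = k"
  by (simp add: avg_def)

lemma avg_permute: "T permutes {1..n} \<Longrightarrow> avg n (\<lambda>i. a (T i)) = avg n a"
  unfolding avg_def using sum.permute[of T "{1..n}" a] by (simp add: o_def)

definition averages_close :: "'a::euclidean_space measure \<Rightarrow> real \<Rightarrow> ('a \<Rightarrow> real) set \<Rightarrow> nat \<Rightarrow> (nat \<Rightarrow> 'a) \<Rightarrow> bool" where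
  "averages_close \<mu> \<delta> H n z \<longleftrightarrow>
     (\<forall>i\<in>{1..n}. z i \<in> usphere) \<and> (\<forall>h\<in>H. \<bar>avg n (\<lambda>i. h (z i)) - (\<integral>x. h x \<partial>\<mu>)\<bar> < \<delta>)"

lemma averages_closeD:
  assumes "averages_close \<mu> \<delta> H n z"
  shows "i \<in> {1..n} \<Longrightarrow> z i \<in> usphere"
    and "h \<in> H \<Longrightarrow> \<bar>avg n (\<lambda>i. h (z i)) - (\<integral>x. h x \<partial>\<mu>)\<bar> < \<delta>"
  using assms unfolding averages_close_def by blast+

lemma averages_close_mono:
  "averages_close \<mu> \<delta> H n z \<Longrightarrow> H' \<subseteq> H \<Longrightarrow> \<delta> \<le> \<delta>' \<Longrightarrow> averages_close \<mu> \<delta>' H' n z"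
  unfolding averages_close_def by (meson order_less_le_trans subsetD)

definition optimal_matching :: "nat \<Rightarrow> (nat \<Rightarrow> 'a::euclidean_space) \<Rightarrow> (nat \<Rightarrow> 'a) \<Rightarrow> (nat \<Rightarrow> nat) \<Rightarrow> bool" where
  "optimal_matching n z g T \<longleftrightarrow> T permutes {1..n} \<and>
     (\<forall>T'. T' permutes {1..n} \<longrightarrow> (\<Sum>i=1..n. cost (z i) (g (T i))) \<le> (\<Sum>i=1..n. cost (z i) (g (T' i))))"

text \<open>
  The dual potential of the matching is extended from the grid to the whole sphere as the largest
  function compatible with the potentials of the sample points. As a minimum of cost functions it
  inherits the modulus of continuity of the cost, whatever the sample and the grid are.
\<close>

lemma optimal_matching_potential:
  fixes z g :: "nat \<Rightarrow> 'a::euclidean_space"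
  assumes opt: "optimal_matching n z g T" and n: "n \<noteq> 0"
    and z: "\<And>i. i \<in> {1..n} \<Longrightarrow> z i \<in> usphere" and g: "\<And>i. i \<in> {1..n} \<Longrightarrow> g i \<in> usphere"
    and x0: "x0 \<in> usphere"
  obtains \<psi> where "cost_modulus \<psi>" "\<psi> x0 = 0"
    "avg n (\<lambda>i. cost (z i) (g (T i))) \<le> avg n (\<lambda>i. conjugate \<psi> (z i)) + avg n (\<lambda>i. \<psi> (g i))"
proof -
  \<comment> \<open>Relabelling the grid by \<open>T\<close> makes the identity the optimal assignment.\<close>
  let ?I = "{1..n}"
  define c where "c i j = cost (z i) (g (T j))" for i j
  have T: "T permutes ?I" using opt by (simp add: optimal_matching_def)
  have "(\<Sum>i\<in>?I. c i i) \<le> (\<Sum>i\<in>?I. c i (T' i))" if "T' permutes ?I" for T'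
    using opt permutes_compose[OF that T] by (auto simp: optimal_matching_def c_def)
  then obtain v where v: "\<And>i j. i \<in> ?I \<Longrightarrow> j \<in> ?I \<Longrightarrow> c i i - v i \<le> c i j - v j"
    by (rule assignment_potentials[OF finite_atLeastAtMost]) (assumption | rule that)+
  define u where "u i = c i i - v i" for i
  define \<psi>' where "\<psi>' y = Min ((\<lambda>i. cost (z i) y - u i) ` ?I)" for y
  have I: "finite ?I" "?I \<noteq> {}" using n by auto
  have \<psi>'_le: "\<psi>' y \<le> cost (z i) y - u i" if "i \<in> ?I" for i y
    unfolding \<psi>'_def using I that by (intro Min_le) auto
  have \<psi>'_att: "\<exists>i\<in>?I. \<psi>' y = cost (z i) y - u i" for y
    using Min_in[of "(\<lambda>i. cost (z i) y - u i) ` ?I"] I unfolding \<psi>'_def by fastforce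
  define \<psi> where "\<psi> y = \<psi>' y - \<psi>' x0" for y
  have mod: "cost_modulus \<psi>"
    unfolding cost_modulus_def
  proof (intro ballI)
    fix x x' :: 'a assume "x \<in> usphere" "x' \<in> usphere"
    obtain i where i: "i \<in> ?I" "\<psi>' x' = cost (z i) x' - u i" using \<psi>'_att by blast
    have "\<psi> x - \<psi> x' \<le> cost x (z i) - cost x' (z i)"
      using \<psi>'_le[OF i(1), of x] i(2) by (simp add: \<psi>_def cost_commute[of _ "z i"])
    then show "\<exists>y\<in>usphere. \<psi> x - \<psi> x' \<le> cost x y - cost x' y"
      using z[OF i(1)] by blast
  qed
  have cu: "u i + \<psi>' x0 \<le> conjugate \<psi> (z i)" if i: "i \<in> ?I" for i
    by (rule conjugate_greatest[OF cost_modulus_continuous[OF mod] z[OF i]])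
       (use \<psi>'_le[OF i] in \<open>simp add: \<psi>_def algebra_simps\<close>)
  have cv: "v i - \<psi>' x0 \<le> \<psi> (g (T i))" if i: "i \<in> ?I" for i
  proof -
    obtain j where "j \<in> ?I" "\<psi>' (g (T i)) = cost (z j) (g (T i)) - u j" using \<psi>'_att by blast
    with v[of j i] i show ?thesis by (simp add: \<psi>_def u_def c_def)
  qed
  have "avg n (\<lambda>i. cost (z i) (g (T i))) \<le> avg n (\<lambda>i. conjugate \<psi> (z i) + \<psi> (g (T i)))"
  proof (rule avg_mono)
    fix i assume "i \<in> ?I"
    with cu[of i] cv[of i] show "cost (z i) (g (T i)) \<le> conjugate \<psi> (z i) + \<psi> (g (T i))"
      by (simp add: u_def c_def)
  qed
  also have "\<dots> = avg n (\<lambda>i. conjugate \<psi> (z i)) + avg n (\<lambda>i. \<psi> (g i))"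
    by (simp add: avg_add avg_permute[OF T, of "\<lambda>i. \<psi> (g i)"])
  finally show ?thesis using mod by (intro that[of \<psi>]) (simp_all add: \<psi>_def)
qed

context sphere_prob_pair
begin

text \<open>
  The potentials of all matchings come from one totally bounded family, so it suffices to control
  finitely many averages. Two of the four errors \<open>e\<close> come from the averages and two from the
  replacement of the potential by a member of the net.
\<close>

lemma optimal_matching_cost_le:
  assumes max: "\<And>\<psi>'. continuous_on usphere \<psi>' \<Longrightarrow> dual_value \<psi>' \<le> V" and e: "0 < e"
  obtains H where "finite H" "\<And>h. h \<in> H \<Longrightarrow> continuous_on usphere h"
    "\<forall>n z g T. n \<noteq> 0 \<longrightarrow> averages_close P e (conjugate ` H) n z \<longrightarrow> averages_close Q e H n g \<longrightarrow>
      optimal_matching n z g T \<longrightarrow> avg n (\<lambda>i. cost (z i) (g (T i))) \<le> V + 4 * e"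
proof -
  obtain x0 :: 'a where x0: "x0 \<in> usphere" using usphere_not_empty by blast
  obtain H :: "('a \<Rightarrow> real) set" where H: "finite H" "\<And>h. h \<in> H \<Longrightarrow> continuous_on usphere h"
    "\<And>\<psi>. cost_modulus \<psi> \<Longrightarrow> \<psi> x0 = 0 \<Longrightarrow> \<exists>h\<in>H. \<forall>x\<in>usphere. \<bar>\<psi> x - h x\<bar> < e"
    by (rule cost_modulus_finite_net[OF e x0]) (rule that)
  show ?thesis
  proof (rule that[OF H(1,2)], assumption, intro allI impI)
    fix n and z g :: "nat \<Rightarrow> 'a" and T
    assume n: "n \<noteq> 0" and Hz: "averages_close P e (conjugate ` H) n z"
      and Hg: "averages_close Q e H n g" and opt: "optimal_matching n z g T"
    note z = averages_closeD(1)[OF Hz] and g = averages_closeD(1)[OF Hg]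
    obtain \<psi> where \<psi>: "cost_modulus \<psi>" "\<psi> x0 = 0"
      "avg n (\<lambda>i. cost (z i) (g (T i))) \<le> avg n (\<lambda>i. conjugate \<psi> (z i)) + avg n (\<lambda>i. \<psi> (g i))"
      by (rule optimal_matching_potential[OF opt n z g x0]) (assumption | rule that)+
    obtain h where h: "h \<in> H" "\<And>x. x \<in> usphere \<Longrightarrow> \<bar>\<psi> x - h x\<bar> < e"
      using H(3)[OF \<psi>(1,2)] by blast
    have "avg n (\<lambda>i. conjugate \<psi> (z i)) \<le> avg n (\<lambda>i. conjugate h (z i) + e)"
    proof (rule avg_mono)
      fix i assume i: "i \<in> {1..n}"
      show "conjugate \<psi> (z i) \<le> conjugate h (z i) + e"
      proof (rule conjugate_le_conjugate[OF H(2)[OF h(1)] cost_modulus_continuous[OF \<psi>(1)] z[OF i]])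
        fix y :: 'a assume "y \<in> usphere"
        from h(2)[OF this] show "h y \<le> \<psi> y + e" by linarith
      qed
    qed
    moreover have "avg n (\<lambda>i. \<psi> (g i)) \<le> avg n (\<lambda>i. h (g i) + e)"
    proof (rule avg_mono)
      fix i assume i: "i \<in> {1..n}"
      from h(2)[OF g[OF i]] show "\<psi> (g i) \<le> h (g i) + e" by linarith
    qed
    ultimately show "avg n (\<lambda>i. cost (z i) (g (T i))) \<le> V + 4 * e"
      using \<psi>(3) averages_closeD(2)[OF Hz imageI[OF h(1)]] averages_closeD(2)[OF Hg h(1)]
        max[OF H(2)[OF h(1)]]
      unfolding avg_add avg_const[OF n] dual_value_def by linarith
  qed
qed

text \<open>
  An optimal matching has small average slack, and a penalised maximum bounds the distance to \<open>F\<close>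
  by a multiple of the slack plus a continuous function of the sample point with small mean.
\<close>

lemma optimal_matching_close:
  assumes \<psi>: "continuous_on usphere \<psi>"
    and max: "\<And>\<psi>'. continuous_on usphere \<psi>' \<Longrightarrow> dual_value \<psi>' \<le> dual_value \<psi>"
    and F: "continuous_on usphere F" "F ` usphere \<subseteq> usphere"
    and zero: "AE x in P. slack \<psi> x (F x) = 0 \<and> (\<forall>y\<in>usphere. slack \<psi> x y = 0 \<longrightarrow> y = F x)"
    and e: "0 < e"
  obtains HP HQ \<delta> where "0 < \<delta>" "finite HP" "finite HQ"
    "\<forall>h\<in>HP. continuous_on usphere h" "\<forall>h\<in>HQ. continuous_on usphere h"
    "\<forall>n z g T. n \<noteq> 0 \<longrightarrow> averages_close P \<delta> HP n z \<longrightarrow> averages_close Q \<delta> HQ n g \<longrightarrow>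
      optimal_matching n z g T \<longrightarrow> avg n (\<lambda>i. norm (g (T i) - F (z i))) < e"
proof -
  define f where "f x y = norm (y - F x)" for x y
  have f: "continuous2 f"
    unfolding f_def by (intro continuous_intros continuous_on_compose2[OF F(1)]) auto
  have Fr: "F x \<in> usphere" if "x \<in> usphere" for x using F(2) that by blast
  have "(\<lambda>k. \<integral>x. fibre_max (\<lambda>x y. f x y - real k * slack \<psi> x y) x \<partial>P) \<longlonglongrightarrow> (\<integral>x. f x (F x) \<partial>P)"
    by (rule P.integral_fibre_max_penalised[OF f \<psi> Fr
          P.continuous_measurable[OF continuous2_graph[OF f F]] zero])
  then have "(\<lambda>k. \<integral>x. fibre_max (\<lambda>x y. f x y - real k * slack \<psi> x y) x \<partial>P) \<longlonglongrightarrow> 0"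
    by (simp add: f_def)
  then have "eventually (\<lambda>k. (\<integral>x. fibre_max (\<lambda>x y. f x y - real k * slack \<psi> x y) x \<partial>P) < e / 3) sequentially"
    using e by (intro order_tendstoD) auto
  then obtain k :: nat where k: "(\<integral>x. fibre_max (\<lambda>x y. f x y - real k * slack \<psi> x y) x \<partial>P) < e / 3"
    by (auto simp: eventually_sequentially)
  define m where "m = fibre_max (\<lambda>x y. f x y - real k * slack \<psi> x y)"
  have arg: "continuous2 (\<lambda>x y. f x y - real k * slack \<psi> x y)"
    by (intro continuous_intros f continuous2_slack \<psi>)
  have m: "continuous_on usphere m" unfolding m_def by (rule continuous_fibre_max[OF arg])
  \<comment> \<open>The average slack will be at most \<open>6 \<delta>\<close>: \<open>4 \<delta>\<close> from the matching cost and \<open>\<delta>\<close> from the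
    average of each of the two potentials.\<close>
  define w where "w = 1 + 6 * real k"
  have w: "0 < w" by (simp add: w_def add_pos_nonneg)
  define \<delta> where "\<delta> = e / 3 / w"
  have "\<delta> * w = e / 3" using w by (simp add: \<delta>_def)
  then have \<delta>: "0 < \<delta>" "\<delta> + real k * (6 * \<delta>) = e / 3"
    using e w by (simp add: \<delta>_def, simp add: w_def algebra_simps)
  obtain H where H: "finite H" "\<And>h. h \<in> H \<Longrightarrow> continuous_on usphere h"
    "\<forall>n z g T. n \<noteq> 0 \<longrightarrow> averages_close P \<delta> (conjugate ` H) n z \<longrightarrow> averages_close Q \<delta> H n g \<longrightarrow>
      optimal_matching n z g T \<longrightarrow> avg n (\<lambda>i. cost (z i) (g (T i))) \<le> dual_value \<psi> + 4 * \<delta>"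
    by (rule optimal_matching_cost_le[OF max \<delta>(1)], assumption) (rule that)
  define HP where "HP = insert m (insert (conjugate \<psi>) (conjugate ` H))"
  define HQ where "HQ = insert \<psi> H"
  show ?thesis
  proof (rule that[OF \<delta>(1), of HP HQ])
    show "finite HP" "finite HQ" using H(1) by (auto simp: HP_def HQ_def)
    show "\<forall>h\<in>HP. continuous_on usphere h" "\<forall>h\<in>HQ. continuous_on usphere h"
      using H(2) \<psi> m continuous_conjugate by (auto simp: HP_def HQ_def)
    show "\<forall>n z g T. n \<noteq> 0 \<longrightarrow> averages_close P \<delta> HP n z \<longrightarrow> averages_close Q \<delta> HQ n g \<longrightarrow>
      optimal_matching n z g T \<longrightarrow> avg n (\<lambda>i. norm (g (T i) - F (z i))) < e"
    proof (intro allI impI)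
      fix n and z g :: "nat \<Rightarrow> 'a" and T
      assume n: "n \<noteq> 0" and Hz: "averages_close P \<delta> HP n z"
        and Hg: "averages_close Q \<delta> HQ n g" and opt: "optimal_matching n z g T"
      note z = averages_closeD(1)[OF Hz] and g = averages_closeD(1)[OF Hg]
      have T: "T permutes {1..n}" using opt by (simp add: optimal_matching_def)
      have gT: "g (T i) \<in> usphere" if "i \<in> {1..n}" for i
        using g permutes_in_image[OF T] that by blast
      have close: "averages_close P \<delta> (conjugate ` H) n z" "averages_close Q \<delta> H n g"
        by (rule averages_close_mono[OF Hz], force simp: HP_def, rule order_refl)
           (rule averages_close_mono[OF Hg], force simp: HQ_def, rule order_refl)
      have "avg n (\<lambda>i. cost (z i) (g (T i))) \<le> dual_value \<psi> + 4 * \<delta>"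
        by (rule H(3)[rule_format, OF n close opt])
      moreover have "avg n (\<lambda>i. slack \<psi> (z i) (g (T i))) =
          avg n (\<lambda>i. cost (z i) (g (T i))) - avg n (\<lambda>i. conjugate \<psi> (z i)) - avg n (\<lambda>i. \<psi> (g i))"
        unfolding slack_def by (simp add: avg_diff avg_permute[OF T, of "\<lambda>i. \<psi> (g i)"])
      moreover have "\<bar>avg n (\<lambda>i. conjugate \<psi> (z i)) - (\<integral>x. conjugate \<psi> x \<partial>P)\<bar> < \<delta>"
        "\<bar>avg n (\<lambda>i. \<psi> (g i)) - (\<integral>y. \<psi> y \<partial>Q)\<bar> < \<delta>"
        using averages_closeD(2)[OF Hz, of "conjugate \<psi>"] averages_closeD(2)[OF Hg, of \<psi>]
        by (auto simp: HP_def HQ_def)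
      ultimately have slack_le: "avg n (\<lambda>i. slack \<psi> (z i) (g (T i))) \<le> 6 * \<delta>"
        unfolding dual_value_def by linarith
      have "avg n (\<lambda>i. f (z i) (g (T i))) \<le> avg n (\<lambda>i. m (z i) + real k * slack \<psi> (z i) (g (T i)))"
      proof (rule avg_mono)
        fix i assume i: "i \<in> {1..n}"
        show "f (z i) (g (T i)) \<le> m (z i) + real k * slack \<psi> (z i) (g (T i))"
          using fibre_max_upper[OF arg z[OF i] gT[OF i]] unfolding m_def by linarith
      qed
      also have "\<dots> = avg n (\<lambda>i. m (z i)) + real k * avg n (\<lambda>i. slack \<psi> (z i) (g (T i)))"
        by (simp add: avg_add avg_cmult)
      also have "\<dots> \<le> avg n (\<lambda>i. m (z i)) + real k * (6 * \<delta>)"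
        using slack_le by (intro add_left_mono mult_left_mono) auto
      also have "avg n (\<lambda>i. m (z i)) < e / 3 + \<delta>"
        using averages_closeD(2)[OF Hz, of m] k by (auto simp: HP_def m_def[symmetric])
      finally have "avg n (\<lambda>i. f (z i) (g (T i))) < e"
        using \<delta>(2) e by simp
      then show "avg n (\<lambda>i. norm (g (T i) - F (z i))) < e" by (simp add: f_def)
    qed
  qed
qed

end

section \<open>Averages over the sample and the grid\<close>

text \<open>
  Nothing relates the different rows of the triangular array, so the bound has to come from each
  row alone; Hoeffding's inequality provides one that tends to \<open>0\<close>.
\<close>

lemma weak_law_continuous:
  fixes Z :: "nat \<Rightarrow> nat \<Rightarrow> 'w \<Rightarrow> 'a::euclidean_space"
  assumes M: "prob_space M" and P: "sphere_prob P"
    and indep: "\<And>n. prob_space.indep_vars M (\<lambda>_. sphere_borel) (Z n) {1..n}"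
    and distr: "\<And>n i. i \<in> {1..n} \<Longrightarrow> distr M sphere_borel (Z n i) = P"
    and h: "continuous_on usphere h" and d: "0 < d"
  shows "\<And>n. {\<omega>\<in>space M. d \<le> \<bar>avg n (\<lambda>i. h (Z n i \<omega>)) - (\<integral>x. h x \<partial>P)\<bar>} \<in> sets M"
    and "(\<lambda>n. measure M {\<omega>\<in>space M. d \<le> \<bar>avg n (\<lambda>i. h (Z n i \<omega>)) - (\<integral>x. h x \<partial>P)\<bar>}) \<longlonglongrightarrow> 0"
proof -
  interpret prob_space M by fact
  interpret P: sphere_prob P by fact
  have h_meas: "h \<in> borel_measurable sphere_borel"
    by (rule borel_measurable_continuous_on_restrict[OF h])
  have Z_meas: "Z n i \<in> M \<rightarrow>\<^sub>M sphere_borel" if "i \<in> {1..n}" for n i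
    using indep[of n] that unfolding indep_vars_def by blast
  have hZ_meas: "(\<lambda>\<omega>. h (Z n i \<omega>)) \<in> borel_measurable M" if "i \<in> {1..n}" for n i
    by (rule measurable_compose[OF Z_meas[OF that] h_meas])
  have avg_meas: "(\<lambda>\<omega>. avg n (\<lambda>i. h (Z n i \<omega>))) \<in> borel_measurable M" for n
    unfolding avg_def by (intro borel_measurable_divide borel_measurable_sum hZ_meas borel_measurable_const)
  show "{\<omega>\<in>space M. d \<le> \<bar>avg n (\<lambda>i. h (Z n i \<omega>)) - (\<integral>x. h x \<partial>P)\<bar>} \<in> sets M" for n
    using avg_meas[of n] by measurable
  obtain B where B: "0 < B" "\<And>x. x \<in> usphere \<Longrightarrow> \<bar>h x\<bar> \<le> B"
    by (rule continuous2_bounded[OF continuous2_one_variable(1)[OF h]]) blast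
  have bound: "measure M {\<omega>\<in>space M. d \<le> \<bar>avg n (\<lambda>i. h (Z n i \<omega>)) - (\<integral>x. h x \<partial>P)\<bar>}
      \<le> 2 * exp (-2 * d\<^sup>2 / (B - (- B))\<^sup>2) ^ n" if n: "1 \<le> n" for n
  proof -
    have in1: "1 \<in> {1..n}" using n by simp
    interpret H: Hoeffding_ineq_iid M "{1..n}" "\<lambda>i \<omega>. h (Z n i \<omega>)" "\<lambda>\<omega>. h (Z n 1 \<omega>)" "- B" B
      "expectation (\<lambda>\<omega>. h (Z n 1 \<omega>))"
    proof unfold_locales
      show "indep_vars (\<lambda>_. borel) (\<lambda>i \<omega>. h (Z n i \<omega>)) {1..n}"
        by (rule indep_vars_compose2[OF indep h_meas])
      show "distr M borel (\<lambda>\<omega>. h (Z n i \<omega>)) = distr M borel (\<lambda>\<omega>. h (Z n 1 \<omega>))" if i: "i \<in> {1..n}" for i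
      proof -
        have "distr M borel (\<lambda>\<omega>. h (Z n j \<omega>)) = distr P borel h" if "j \<in> {1..n}" for j
          using distr_distr[OF h_meas Z_meas[OF that]] distr[OF that] by (simp add: o_def)
        from this[OF i] this[OF in1] show ?thesis by simp
      qed
      show "random_variable borel (\<lambda>\<omega>. h (Z n 1 \<omega>))" by (rule hZ_meas[OF in1])
      show "AE \<omega> in M. h (Z n 1 \<omega>) \<in> {- B..B}"
      proof (rule AE_I2)
        fix \<omega> assume "\<omega> \<in> space M"
        then have "Z n 1 \<omega> \<in> usphere"
          using measurable_space[OF Z_meas[OF in1]] by (simp add: space_restrict_space)
        from B(2)[OF this] show "h (Z n 1 \<omega>) \<in> {- B..B}" by auto
      qed
    qed auto
    have mean: "expectation (\<lambda>\<omega>. h (Z n 1 \<omega>)) = (\<integral>x. h x \<partial>P)"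
      using integral_distr[OF Z_meas[OF in1] h_meas] distr[OF in1] by simp
    have "measure M {\<omega>\<in>space M. d \<le> \<bar>avg n (\<lambda>i. h (Z n i \<omega>)) - (\<integral>x. h x \<partial>P)\<bar>}
        \<le> 2 * exp (-2 * real (card {1..n}) * d\<^sup>2 / (B - (- B))\<^sup>2)"
      using H.Hoeffding_ineq_abs_ge'[of d] d B(1) n unfolding mean avg_def by simp
    also have "-2 * real (card {1..n}) * d\<^sup>2 / (B - (- B))\<^sup>2 = real n * (-2 * d\<^sup>2 / (B - (- B))\<^sup>2)"
      by simp
    finally show ?thesis unfolding exp_of_nat_mult .
  qed
  have "exp (-2 * d\<^sup>2 / (B - (- B))\<^sup>2) < 1"
    using d B(1) by simp
  then have "(\<lambda>n. 2 * exp (-2 * d\<^sup>2 / (B - (- B))\<^sup>2) ^ n) \<longlonglongrightarrow> 2 * 0"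
    by (intro tendsto_mult tendsto_const LIMSEQ_realpow_zero) auto
  then have lim: "(\<lambda>n. 2 * exp (-2 * d\<^sup>2 / (B - (- B))\<^sup>2) ^ n) \<longlonglongrightarrow> 0" by simp
  show "(\<lambda>n. measure M {\<omega>\<in>space M. d \<le> \<bar>avg n (\<lambda>i. h (Z n i \<omega>)) - (\<integral>x. h x \<partial>P)\<bar>}) \<longlonglongrightarrow> 0"
  proof (rule tendsto_sandwich[OF _ _ tendsto_const lim])
    show "eventually (\<lambda>n. measure M {\<omega>\<in>space M. d \<le> \<bar>avg n (\<lambda>i. h (Z n i \<omega>)) - (\<integral>x. h x \<partial>P)\<bar>}
        \<le> 2 * exp (-2 * d\<^sup>2 / (B - (- B))\<^sup>2) ^ n) sequentially"
      using bound unfolding eventually_sequentially by blast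
  qed simp
qed

lemma grid_average_convergence:
  fixes g :: "nat \<Rightarrow> nat \<Rightarrow> 'a::euclidean_space"
  assumes inj: "\<And>n. inj_on (g n) {1..n}" and sphere: "\<And>n. g n ` {1..n} \<subseteq> usphere"
    and conv: "weak_conv_sphere (\<lambda>n. uniform_grid n (g n)) U" and h: "continuous_on usphere h"
  shows "(\<lambda>n. avg n (\<lambda>i. h (g n i))) \<longlonglongrightarrow> (\<integral>y. h y \<partial>U)"
proof -
  have "(\<integral>y. h y \<partial>uniform_grid n (g n)) = avg n (\<lambda>i. h (g n i))" for n
  proof -
    have "(\<lambda>x. x) \<in> uniform_count_measure (g n ` {1..n}) \<rightarrow>\<^sub>M sphere_borel"
      using sphere[of n]
      by (auto simp: measurable_def space_uniform_count_measure sets_uniform_count_measure space_restrict_space)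
    then have "(\<integral>y. h y \<partial>uniform_grid n (g n)) = (\<integral>y. h y \<partial>uniform_count_measure (g n ` {1..n}))"
      unfolding uniform_grid_def
      by (rule integral_distr) (rule borel_measurable_continuous_on_restrict[OF h])
    also have "\<dots> = avg n (\<lambda>i. h (g n i))"
      unfolding integral_uniform_count_measure[OF finite_imageI[OF finite_atLeastAtMost]]
        sum.reindex[OF inj] card_image[OF inj] avg_def by (simp add: o_def)
    finally show ?thesis .
  qed
  moreover have "bounded (h ` usphere)"
    by (intro compact_imp_bounded compact_continuous_image h compact_sphere)
  ultimately show ?thesis
    using conv h unfolding weak_conv_sphere_def by auto
qed

text \<open>A bijection onto \<open>n\<close> distinct grid points exists only if the sample points are distinct.\<close>

lemma empirical_df_optimal_matching:
  assumes F: "empirical_df n z g F" and inj: "inj_on g {1..n}"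
  obtains T where "optimal_matching n z g T" "\<And>i. i \<in> {1..n} \<Longrightarrow> F (z i) = g (T i)"
proof -
  let ?I = "{1..n}"
  have bij: "bij_betw F (z ` ?I) (g ` ?I)"
    and eq: "(\<Sum>i=1..n. cost (z i) (F (z i))) = Min ((\<lambda>T. \<Sum>i=1..n. cost (z i) (g (T i))) ` {T. T permutes ?I})"
    using F by (auto simp: empirical_df_def)
  have "card (z ` ?I) = card ?I"
    using bij_betw_same_card[OF bij] card_image[OF inj] by simp
  then have "inj_on z ?I" by (simp add: eq_card_imp_inj_on)
  then have bz: "bij_betw z ?I (z ` ?I)" by (simp add: bij_betw_def)
  have bg: "bij_betw g ?I (g ` ?I)" using inj by (simp add: bij_betw_def)
  define T where "T i = (if i \<in> ?I then inv_into ?I g (F (z i)) else i)" for i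
  have "bij_betw (inv_into ?I g \<circ> (F \<circ> z)) ?I ?I"
    by (rule bij_betw_trans[OF bij_betw_trans[OF bz bij] bij_betw_inv_into[OF bg]])
  then have "bij_betw T ?I ?I"
    by (rule bij_betw_cong[THEN iffD1, rotated]) (simp add: T_def)
  then have T: "T permutes ?I" by (rule bij_imp_permutes) (auto simp: T_def)
  have FT: "F (z i) = g (T i)" if i: "i \<in> ?I" for i
  proof -
    have "F (z i) \<in> g ` ?I" using bij i by (auto simp: bij_betw_def)
    then show ?thesis using i by (simp add: T_def f_inv_into_f)
  qed
  have "(\<Sum>i=1..n. cost (z i) (g (T i))) \<le> (\<Sum>i=1..n. cost (z i) (g (T' i)))" if "T' permutes ?I" for T'
  proof -
    have "(\<Sum>i=1..n. cost (z i) (g (T i))) = (\<Sum>i=1..n. cost (z i) (F (z i)))"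
      by (rule sum.cong) (simp_all add: FT)
    also have "\<dots> \<le> (\<Sum>i=1..n. cost (z i) (g (T' i)))"
      unfolding eq using that by (intro Min_le finite_imageI finite_permutations) auto
    finally show ?thesis .
  qed
  then show ?thesis using that[of T] T FT by (simp add: optimal_matching_def)
qed

lemma directional_df_usphere:
  assumes "directional_df P F"
  shows "continuous_on usphere F" "F ` usphere \<subseteq> usphere"
proof -
  show "continuous_on usphere F" using assms by (simp add: directional_df_def)
  have "F \<in> sphere_borel \<rightarrow>\<^sub>M sphere_borel" using assms by (simp add: directional_df_def transports_def)
  from measurable_space[OF this] show "F ` usphere \<subseteq> usphere" by (auto simp: space_restrict_space)
qed

lemma norm_diff_square_lipschitz:
  assumes "x \<in> usphere" "y \<in> usphere" "w \<in> usphere"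
  shows "\<bar>(norm (x - w))\<^sup>2 - (norm (y - w))\<^sup>2\<bar> \<le> 4 * norm (x - y)"
proof -
  have "(norm (x - w))\<^sup>2 - (norm (y - w))\<^sup>2 = (norm (x - w) + norm (y - w)) * (norm (x - w) - norm (y - w))"
    by (simp add: power2_eq_square algebra_simps)
  also have "\<bar>\<dots>\<bar> = (norm (x - w) + norm (y - w)) * \<bar>norm (x - w) - norm (y - w)\<bar>"
    by (simp add: abs_mult)
  also have "\<dots> \<le> 4 * norm (x - y)"
  proof (rule mult_mono)
    show "norm (x - w) + norm (y - w) \<le> 4"
      using assms norm_triangle_ineq4[of x w] norm_triangle_ineq4[of y w] by simp
    show "\<bar>norm (x - w) - norm (y - w)\<bar> \<le> norm (x - y)"
      using norm_triangle_ineq3[of "x - w" "y - w"] by simp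
  qed auto
  finally show ?thesis .
qed

text \<open>
  Squared distances on the sphere are Lipschitz with constant \<open>4\<close>, so the statistic differs from
  the sample average of \<open>(norm (F x - F0 x))\<^sup>2\<close> by at most four times the average distance between
  the matching and \<open>F\<close>. Both are controlled outside finitely many measurable deviation events and
  a null set, which bounds the outer measure although the statistic may fail to be measurable.
\<close>

lemma T_stat_limit:
  fixes M :: "'w measure" and Z :: "nat \<Rightarrow> nat \<Rightarrow> 'w \<Rightarrow> 'a::euclidean_space"
  assumes dim: "2 \<le> DIM('a)" and M: "prob_space M" and P: "P \<in> directional_family"
    and indep: "\<And>n. prob_space.indep_vars M (\<lambda>_. sphere_borel) (Z n) {1..n}"
    and distr: "\<And>n i. i \<in> {1..n} \<Longrightarrow> distr M sphere_borel (Z n i) = P"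
    and F: "directional_df P F" and F0: "continuous_on usphere F0" "F0 ` usphere \<subseteq> usphere"
    and grid_inj: "\<And>n. inj_on (g n) {1..n}" and grid_sphere: "\<And>n. g n ` {1..n} \<subseteq> usphere"
    and Fn: "\<And>n. AE \<omega> in M. empirical_df n (\<lambda>i. Z n i \<omega>) (g n) (Fn n \<omega>)"
    and grid_conv: "weak_conv_sphere (\<lambda>n. uniform_grid n (g n)) uniform_sphere"
  shows "conv_in_prob M (T_stat Z Fn F0) (\<integral>x. (norm (F x - F0 x))\<^sup>2 \<partial>P)"
  unfolding conv_in_prob_def
proof (intro allI impI)
  fix \<epsilon> :: real assume \<epsilon>: "0 < \<epsilon>"
  interpret prob_space M by fact
  interpret D: sphere_prob_pair P uniform_sphere
    unfolding sphere_prob_pair_def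
    using sphere_prob_directional_family[OF P] sphere_prob_uniform by blast
  note Fc = directional_df_usphere[OF F]
  obtain \<psi> where \<psi>: "continuous_on usphere \<psi>"
    and max: "\<And>\<psi>'. continuous_on usphere \<psi>' \<Longrightarrow> D.dual_value \<psi>' \<le> D.dual_value \<psi>"
    and zero: "AE x in P. slack \<psi> x (F x) = 0 \<and> (\<forall>y\<in>usphere. slack \<psi> x y = 0 \<longrightarrow> y = F x)"
    by (rule directional_df_potential[OF dim P F]) (rule that)
  have e8: "0 < \<epsilon> / 8" using \<epsilon> by simp
  obtain HP HQ :: "('a \<Rightarrow> real) set" and \<delta> where \<delta>: "0 < \<delta>" and fin: "finite HP" "finite HQ"
    and contP: "\<forall>h\<in>HP. continuous_on usphere h" and contQ: "\<forall>h\<in>HQ. continuous_on usphere h"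
    and close: "\<forall>n z g T. n \<noteq> 0 \<longrightarrow> averages_close P \<delta> HP n z \<longrightarrow> averages_close uniform_sphere \<delta> HQ n g \<longrightarrow>
      optimal_matching n z g T \<longrightarrow> avg n (\<lambda>i. norm (g (T i) - F (z i))) < \<epsilon> / 8"
    by (rule D.optimal_matching_close[OF \<psi> max Fc zero e8], assumption) (rule that)
  define q where "q x = (norm (F x - F0 x))\<^sup>2" for x
  have q: "continuous_on usphere q" unfolding q_def by (intro continuous_intros Fc(1) F0(1))
  define d where "d = min \<delta> (\<epsilon> / 2)"
  have d: "0 < d" using \<delta> \<epsilon> by (simp add: d_def)
  define H where "H = insert q HP"
  have H: "finite H" "\<And>h. h \<in> H \<Longrightarrow> continuous_on usphere h"
    using fin(1) contP q by (auto simp: H_def)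
  define bad where "bad h n = {\<omega>\<in>space M. d \<le> \<bar>avg n (\<lambda>i. h (Z n i \<omega>)) - (\<integral>x. h x \<partial>P)\<bar>}" for h n
  have bad_sets: "bad h n \<in> sets M" if "h \<in> H" for h n
    unfolding bad_def
    by (rule weak_law_continuous(1)[OF M D.P.sphere_prob_axioms indep distr H(2)[OF that] d])
  have bad_lim: "(\<lambda>n. measure M (bad h n)) \<longlonglongrightarrow> 0" if "h \<in> H" for h
    unfolding bad_def
    by (rule weak_law_continuous(2)[OF M D.P.sphere_prob_axioms indep distr H(2)[OF that] d])
  have grid: "eventually (\<lambda>n. \<forall>h\<in>HQ. \<bar>avg n (\<lambda>i. h (g n i)) - (\<integral>y. h y \<partial>uniform_sphere)\<bar> < \<delta>) sequentially"
  proof (rule eventually_ball_finite[OF fin(2)], rule ballI)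
    fix h assume "h \<in> HQ"
    from tendstoD[OF grid_average_convergence[OF grid_inj grid_sphere grid_conv contQ[rule_format, OF this]] \<delta>]
    show "eventually (\<lambda>n. \<bar>avg n (\<lambda>i. h (g n i)) - (\<integral>y. h y \<partial>uniform_sphere)\<bar> < \<delta>) sequentially"
      by (simp add: dist_real_def)
  qed
  have outer_le: "outer_measure_of M {\<omega> \<in> space M. \<bar>T_stat Z Fn F0 n \<omega> - (\<integral>x. q x \<partial>P)\<bar> > \<epsilon>}
      \<le> ennreal (\<Sum>h\<in>H. measure M (bad h n))"
    if n: "n \<noteq> 0" and G: "\<forall>h\<in>HQ. \<bar>avg n (\<lambda>i. h (g n i)) - (\<integral>y. h y \<partial>uniform_sphere)\<bar> < \<delta>" for n
  proof -
    obtain N where "{\<omega>\<in>space M. \<not> empirical_df n (\<lambda>i. Z n i \<omega>) (g n) (Fn n \<omega>)} \<subseteq> N"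
      "emeasure M N = 0" "N \<in> sets M"
      by (rule AE_E[OF Fn[of n]]) (rule that)
    then have N: "N \<in> null_sets M" "{\<omega>\<in>space M. \<not> empirical_df n (\<lambda>i. Z n i \<omega>) (g n) (Fn n \<omega>)} \<subseteq> N"
      by auto
    have "\<bar>T_stat Z Fn F0 n \<omega> - (\<integral>x. q x \<partial>P)\<bar> \<le> \<epsilon>"
      if \<omega>: "\<omega> \<in> space M" "\<omega> \<notin> N" "\<And>h. h \<in> H \<Longrightarrow> \<omega> \<notin> bad h n" for \<omega>
    proof -
      define z where "z i = Z n i \<omega>" for i
      have z: "z i \<in> usphere" if "i \<in> {1..n}" for i
      proof -
        have "Z n i \<in> M \<rightarrow>\<^sub>M sphere_borel" using indep[of n] that unfolding indep_vars_def by blast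
        from measurable_space[OF this \<omega>(1)] show ?thesis by (simp add: z_def space_restrict_space)
      qed
      have gs: "g n i \<in> usphere" if "i \<in> {1..n}" for i using grid_sphere[of n] that by blast
      have "empirical_df n z (g n) (Fn n \<omega>)" using N(2) \<omega>(1,2) unfolding z_def by blast
      then obtain T where T: "optimal_matching n z (g n) T"
        and FT: "\<And>i. i \<in> {1..n} \<Longrightarrow> Fn n \<omega> (z i) = g n (T i)"
        by (rule empirical_df_optimal_matching[OF _ grid_inj]) (rule that)
      have Tp: "T permutes {1..n}" using T by (simp add: optimal_matching_def)
      have good: "\<bar>avg n (\<lambda>i. h (z i)) - (\<integral>x. h x \<partial>P)\<bar> < d" if "h \<in> H" for h
        using \<omega>(3)[OF that] \<omega>(1) by (simp add: bad_def z_def)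
      have "averages_close P d H n z"
        unfolding averages_close_def using z good by blast
      then have z_close: "averages_close P \<delta> HP n z"
        by (rule averages_close_mono) (auto simp: H_def d_def)
      have g_close: "averages_close uniform_sphere \<delta> HQ n (g n)"
        unfolding averages_close_def using gs G by blast
      have "avg n (\<lambda>i. norm (g n (T i) - F (z i))) < \<epsilon> / 8"
        by (rule close[rule_format, OF n z_close g_close T])
      moreover have "\<bar>T_stat Z Fn F0 n \<omega> - avg n (\<lambda>i. q (z i))\<bar> \<le> 4 * avg n (\<lambda>i. norm (g n (T i) - F (z i)))"
      proof -
        have pt: "\<bar>(norm (Fn n \<omega> (z i) - F0 (z i)))\<^sup>2 - q (z i)\<bar> \<le> 4 * norm (g n (T i) - F (z i))"
          if i: "i \<in> {1..n}" for i
        proof -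
          have "g n (T i) \<in> usphere" using gs permutes_in_image[OF Tp] i by blast
          then show ?thesis
            unfolding FT[OF i] q_def
            by (rule norm_diff_square_lipschitz) (use Fc(2) F0(2) z[OF i] in blast)+
        qed
        have T_eq: "T_stat Z Fn F0 n \<omega> = avg n (\<lambda>i. (norm (Fn n \<omega> (z i) - F0 (z i)))\<^sup>2)"
          by (simp add: T_stat_def avg_def z_def)
        have "avg n (\<lambda>i. (norm (Fn n \<omega> (z i) - F0 (z i)))\<^sup>2 - q (z i)) \<le> avg n (\<lambda>i. 4 * norm (g n (T i) - F (z i)))"
          "avg n (\<lambda>i. q (z i) - (norm (Fn n \<omega> (z i) - F0 (z i)))\<^sup>2) \<le> avg n (\<lambda>i. 4 * norm (g n (T i) - F (z i)))"
          by (rule avg_mono, drule pt, linarith)+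
        then show ?thesis unfolding T_eq avg_diff avg_cmult by linarith
      qed
      moreover have "\<bar>avg n (\<lambda>i. q (z i)) - (\<integral>x. q x \<partial>P)\<bar> < \<epsilon> / 2"
        using good[of q] by (simp add: H_def d_def)
      ultimately show ?thesis by linarith
    qed
    then have sub: "{\<omega> \<in> space M. \<bar>T_stat Z Fn F0 n \<omega> - (\<integral>x. q x \<partial>P)\<bar> > \<epsilon>} \<subseteq> N \<union> (\<Union>h\<in>H. bad h n)"
      unfolding not_le[symmetric] by blast
    have un: "(\<Union>h\<in>H. bad h n) \<in> sets M" using H(1) bad_sets by (intro sets.finite_UN) auto
    then have NU: "N \<union> (\<Union>h\<in>H. bad h n) \<in> sets M" using N(1) by blast
    have "outer_measure_of M {\<omega> \<in> space M. \<bar>T_stat Z Fn F0 n \<omega> - (\<integral>x. q x \<partial>P)\<bar> > \<epsilon>}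
        \<le> emeasure M (N \<union> (\<Union>h\<in>H. bad h n))"
      using outer_measure_of_mono[OF sub, of M] unfolding outer_measure_of_eq[OF NU] .
    also have "\<dots> = emeasure M (\<Union>h\<in>H. bad h n)"
      using emeasure_Un_null_set[OF un N(1)] by (simp add: Un_commute)
    also have "\<dots> \<le> ennreal (\<Sum>h\<in>H. measure M (bad h n))"
      unfolding emeasure_eq_measure
      by (intro ennreal_leI finite_measure_subadditive_finite H(1)) (use bad_sets in auto)
    finally show ?thesis .
  qed
  have "(\<lambda>n. \<Sum>h\<in>H. measure M (bad h n)) \<longlonglongrightarrow> (\<Sum>h\<in>H. 0)"
    by (intro tendsto_sum bad_lim)
  then have lim: "(\<lambda>n. ennreal (\<Sum>h\<in>H. measure M (bad h n))) \<longlonglongrightarrow> 0"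
    using tendsto_ennrealI[of _ "0::real"] by simp
  show "(\<lambda>n. outer_measure_of M {\<omega> \<in> space M.
      \<bar>T_stat Z Fn F0 n \<omega> - (\<integral>x. (norm (F x - F0 x))\<^sup>2 \<partial>P)\<bar> > \<epsilon>}) \<longlonglongrightarrow> 0"
    unfolding q_def[symmetric]
  proof (rule tendsto_sandwich[OF _ _ tendsto_const lim])
    show "eventually (\<lambda>n. outer_measure_of M {\<omega> \<in> space M. \<bar>T_stat Z Fn F0 n \<omega> - (\<integral>x. q x \<partial>P)\<bar> > \<epsilon>}
        \<le> ennreal (\<Sum>h\<in>H. measure M (bad h n))) sequentially"
      using grid eventually_gt_at_top[of 0]
    proof eventually_elim
      case (elim n)
      then show ?case by (intro outer_le) simp_all
    qed
  qed simp
qed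

text \<open>
  Two different continuous maps differ on a nonempty open set, which has positive probability
  because the density is bounded away from zero.
\<close>

lemma integral_norm_diff_pos:
  fixes F F0 :: "'a::euclidean_space \<Rightarrow> 'a"
  assumes P: "P \<in> directional_family"
    and F: "continuous_on usphere F" "continuous_on usphere F0"
    and x: "x \<in> usphere" "F x \<noteq> F0 x"
  shows "0 < (\<integral>x. (norm (F x - F0 x))\<^sup>2 \<partial>P)"
proof -
  interpret P: sphere_prob P by (rule sphere_prob_directional_family[OF P])
  define q where "q x = (norm (F x - F0 x))\<^sup>2" for x
  have q: "continuous_on usphere q" unfolding q_def by (intro continuous_intros F)
  have nonneg: "AE x in P. 0 \<le> q x" by (simp add: q_def)
  have "(\<integral>x. q x \<partial>P) \<noteq> 0"
  proof
    assume "(\<integral>x. q x \<partial>P) = 0"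
    then have AE: "AE x in P. q x = 0"
      using integral_nonneg_eq_0_iff_AE[OF P.continuous_integrable[OF q] nonneg] by simp
    obtain W where W: "open W" "W \<inter> usphere = q -` {0<..} \<inter> usphere"
      using q open_greaterThan unfolding continuous_on_open_invariant by blast
    have "x \<in> W \<inter> usphere" using W(2) x by (auto simp: q_def)
    then have "0 < emeasure P (W \<inter> usphere)"
      by (intro directional_family_open_pos[OF P W(1)]) auto
    moreover have "AE x in P. \<not> x \<in> W \<inter> usphere"
      using AE by (rule eventually_mono) (use W(2) in auto)
    then have "emeasure P {x \<in> space P. x \<in> W \<inter> usphere} = 0" by (rule emeasure_eq_0_AE)
    then have "emeasure P (W \<inter> usphere) = 0" by (simp add: Int_def conj_commute conj_left_commute)
    ultimately show False by simp
  qed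
  with integral_nonneg_AE[OF nonneg] have "0 < (\<integral>x. q x \<partial>P)" by linarith
  then show ?thesis unfolding q_def .
qed

section \<open>The two hypotheses\<close>

theorem proposition6:
  fixes M :: "'w measure"
    and Z :: "nat \<Rightarrow> nat \<Rightarrow> 'w \<Rightarrow> 'a::euclidean_space"
    and P P0 :: "'a measure"
    and F F0 :: "'a \<Rightarrow> 'a"
    and g :: "nat \<Rightarrow> nat \<Rightarrow> 'a"
    and Fn :: "nat \<Rightarrow> 'w \<Rightarrow> 'a \<Rightarrow> 'a"
  assumes dim: "2 \<le> DIM('a)"
    and M: "prob_space M"
    and P: "P \<in> directional_family"
    and indep: "\<And>n. prob_space.indep_vars M (\<lambda>_. sphere_borel) (Z n) {1..n}"
    and distr: "\<And>n i. i \<in> {1..n} \<Longrightarrow> distr M sphere_borel (Z n i) = P"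
    and F: "directional_df P F"
    and P0: "P0 \<in> directional_family"
    and F0: "directional_df P0 F0"
    and grid_inj: "\<And>n. inj_on (g n) {1..n}"
    and grid_sphere: "\<And>n. g n ` {1..n} \<subseteq> usphere"
    and Fn: "\<And>n. AE \<omega> in M. empirical_df n (\<lambda>i. Z n i \<omega>) (g n) (Fn n \<omega>)"
    and grid_conv: "weak_conv_sphere (\<lambda>n. uniform_grid n (g n)) uniform_sphere"
  shows "((\<forall>x\<in>usphere. F x = F0 x) \<longrightarrow> conv_in_prob M (T_stat Z Fn F0) 0) \<and>
         ((\<exists>x\<in>usphere. F x \<noteq> F0 x) \<longrightarrow> (\<exists>c>0. conv_in_prob M (T_stat Z Fn F0) c))"
proof -
  interpret P: sphere_prob P by (rule sphere_prob_directional_family[OF P])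
  note Fc = directional_df_usphere[OF F] and F0c = directional_df_usphere[OF F0]
  define c where "c = (\<integral>x. (norm (F x - F0 x))\<^sup>2 \<partial>P)"
  have lim: "conv_in_prob M (T_stat Z Fn F0) c"
    unfolding c_def
    by (rule T_stat_limit[OF dim M P indep distr F F0c grid_inj grid_sphere Fn grid_conv])
  show ?thesis
  proof (intro conjI impI)
    assume "\<forall>x\<in>usphere. F x = F0 x"
    then have "c = (\<integral>x. 0 \<partial>P)"
      unfolding c_def by (intro Bochner_Integration.integral_cong) auto
    then show "conv_in_prob M (T_stat Z Fn F0) 0" using lim by simp
  next
    assume "\<exists>x\<in>usphere. F x \<noteq> F0 x"
    then have "0 < c"
      unfolding c_def using integral_norm_diff_pos[OF P Fc(1) F0c(1)] by blast
    with lim show "\<exists>c>0. conv_in_prob M (T_stat Z Fn F0) c" by blast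
  qed
qed

end
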